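(* Let $n\in\mathbb{N}$ and write $n+2=2^\alpha3^\beta n_1$ with $\alpha,\beta\ge0$ integers and $\gcd(6,n_1)=1$. Then $$t(1,3,3,9;n)=\begin{cases}0 & \text{if } n\equiv 2,5\pmod 6,\\ 16\sigma(n_1) & \text{if } n\equiv1\pmod 6,\\ 2^{\alpha+4}\sigma(n_1) & \text{if } n\equiv 4\pmod 6,\\ 8\sigma(n_1) & \text{if } n\equiv 3\pmod 6,\\ 2^{\alpha+3}\sigma(n_1) & \text{if } n\equiv 0\pmod 6.\end{cases}$$
   Context: $\mathbb{N}$ denotes the set of positive integers. For $a,b,c,d\in\mathbb{N}$ and an integer $m\ge0$, $t(a,b,c,d;m)$ is the number of $(x,y,z,w)\in\mathbb{Z}^4$ with $m = a\frac{x(x-1)}{2}+b\frac{y(y-1)}{2}+c\frac{z(z-1)}{2}+d\frac{w(w-1)}{2}$. $\sigma(m)$ is the sum of the positive divisors of $m$. *)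

theory Defs
  imports Main
begin

definition sigma :: "nat \<Rightarrow> nat" where
  "sigma m = (\<Sum>d | d dvd m. d)"

(* The division is exact, since x * (x - 1) is even. *)
definition tri :: "int \<Rightarrow> int" where
  "tri x = x * (x - 1) div 2"

definition tri_reps :: "nat \<Rightarrow> nat \<Rightarrow> nat \<Rightarrow> nat \<Rightarrow> nat \<Rightarrow> (int \<times> int \<times> int \<times> int) set" where
  "tri_reps a b c d m =
     {(x, y, z, w). int m = int a * tri x + int b * tri y + int c * tri z + int d * tri w}"

(* Meaningful for positive a, b, c, d only: then tri_reps is finite (see finite_tri_reps),
   so that card is the true number of representations. *)
definition t :: "nat \<Rightarrow> nat \<Rightarrow> nat \<Rightarrow> nat \<Rightarrow> nat \<Rightarrow> nat" where
  "t a b c d m = card (tri_reps a b c d m)"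

lemma two_tri: "2 * tri x = x * (x - 1)"
  by (simp add: tri_def)

lemma tri_nonneg: "0 \<le> tri x"
proof -
  have "0 \<le> x * (x - 1)"
    by (cases "x \<le> 0") (auto simp: zero_le_mult_iff)
  then show ?thesis
    using two_tri[of x] by linarith
qed

lemma tri_bound: "\<bar>x\<bar> \<le> tri x + 1"
proof (cases "x \<le> 0")
  case True
  then have "0 \<le> x * (x + 1)"
    by (cases "x = 0") (auto simp: zero_le_mult_iff)
  then show ?thesis
    using True two_tri[of x] by (simp add: algebra_simps)
next
  case False
  have "0 \<le> (x - 1) * (x - 2)"
    using False by (cases "x = 1") auto
  then show ?thesis
    using False two_tri[of x] by (simp add: algebra_simps)
qed

lemma finite_tri_reps:
  assumes "a > 0" "b > 0" "c > 0" "d > 0"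
  shows "finite (tri_reps a b c d m)"
proof (rule finite_subset)
  let ?I = "{- int m - 1 .. int m + 1}"
  show "finite (?I \<times> ?I \<times> ?I \<times> ?I)"
    by simp
  have le: "tri u \<le> int k * tri u" if "k > 0" for k u
    using that mult_right_mono[of 1 "int k" "tri u"] tri_nonneg[of u] by simp
  have bd: "u \<in> ?I" if "tri u \<le> int m" for u
    using that tri_bound[of u] unfolding atLeastAtMost_iff by linarith
  show "tri_reps a b c d m \<subseteq> ?I \<times> ?I \<times> ?I \<times> ?I"
  proof
    fix p
    assume p: "p \<in> tri_reps a b c d m"
    obtain x y z w where xyzw: "p = (x, y, z, w)"
      by (cases p) auto
    have "(x, y, z, w) \<in> tri_reps a b c d m"
      using p xyzw by simp
    then have eq: "int m = int a * tri x + int b * tri y + int c * tri z + int d * tri w"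
      by (simp add: tri_reps_def)
    have "tri x \<le> int m" "tri y \<le> int m" "tri z \<le> int m" "tri w \<le> int m"
      using eq le[OF assms(1), of x] le[OF assms(2), of y] le[OF assms(3), of z]
        le[OF assms(4), of w] tri_nonneg[of x] tri_nonneg[of y] tri_nonneg[of z] tri_nonneg[of w]
      by linarith+
    then show "p \<in> ?I \<times> ?I \<times> ?I \<times> ?I"
      unfolding xyzw using bd by blast
  qed
qed

end

(* Completing squares turns representations of n into solutions of
   x^2 + 3 y^2 + 3 z^2 + 9 w^2 = 8 (n + 2) in odd integers. Modulo 3 this reduces to counting odd
   solutions of x^2 + y^2 + 3 z^2 + 3 w^2 = 8 N, that is, to a convolution of the numbers of odd
   solutions of x^2 + 3 z^2 = 4 k. For odd k the latter number is four times the sum of chi(d) over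
   the divisors d of k, with chi the nontrivial character modulo 3; this follows from the recursion
   r(p k) = (1 + chi(p)) r(k) - chi(p) r(k / p) for the number r of representations by
   x^2 + x y + y^2. The convolution is then a sum of chi(a) chi(b) over a x + b y = 2 N with all
   variables odd. As chi(a) chi(b) = F(a - b) - F(a + b) for F the indicator of the multiples
   of 3, a classical identity of Liouville evaluates it as the sum of the divisors d of N with
   N / d odd and d prime to 3. *)
theory Submission
  imports Defs "HOL-Number_Theory.Number_Theory" "HOL-Library.Discrete_Functions"
begin

subsection \<open>Representations by \<open>x\<^sup>2 + x y + y\<^sup>2\<close>\<close>

text \<open>The recursion takes the place of unique factorization in the Eisenstein integers: the
  number of elements of norm \<open>k\<close> and the character sum both obey it at every prime
  factor of \<open>k\<close>. Strong induction therefore needs no ideals, and the only existence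
  statement is an element of norm \<open>p\<close> for each prime \<open>p = 1 (mod 3)\<close>. The
  constant 4 is the number 6 of units times the proportion 2/3 of elements of odd norm whose second
  coordinate is odd; its square is the 16 of the theorem. The power of 3 in \<open>N\<close> leaves
  no trace in the final divisor sum, because \<open>F 0 - F (2 * d)\<close> vanishes at the
  multiples \<open>d\<close> of 3. Hence, with \<open>N = n + 2\<close>, a multiple \<open>N\<close>
  of 3 can be replaced by \<open>N / 3\<close> without changing the value. For
  \<open>N = 2 (mod 3)\<close> the wanted count is exactly half of that for the coefficients 1, 1,
  3, 3, which explains the factor 2 between the formulas.\<close>

definition eis_reps :: "int \<Rightarrow> (int \<times> int) set" where
  "eis_reps k = {(x, y). x\<^sup>2 + x * y + y\<^sup>2 = k}"

lemma in_eis_reps [simp]: "(x, y) \<in> eis_reps k \<longleftrightarrow> x\<^sup>2 + x * y + y\<^sup>2 = k"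
  by (simp add: eis_reps_def)

text \<open>Twice the form exceeds \<open>x^2 + y^2\<close> by the square
  \<open>(x + y)^2\<close>.\<close>

lemma eis_reps_bound:
  fixes x y :: int
  assumes "x\<^sup>2 + x * y + y\<^sup>2 = k"
  shows "x\<^sup>2 + y\<^sup>2 \<le> 2 * k"
proof -
  have "0 \<le> (x + y)\<^sup>2" by simp
  then show ?thesis using assms by (simp add: power2_eq_square algebra_simps)
qed

lemma abs_le_square: "\<bar>x\<bar> \<le> (x::int)\<^sup>2"
proof (cases "x = 0")
  case False
  then have "\<bar>x\<bar> * 1 \<le> \<bar>x\<bar> * \<bar>x\<bar>" by (intro mult_left_mono) auto
  then show ?thesis by (simp add: power2_eq_square)
qed simp

lemma finite_eis_reps: "finite (eis_reps k)"
proof (rule finite_subset)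
  show "eis_reps k \<subseteq> {-(2*k)..2*k} \<times> {-(2*k)..2*k}"
  proof
    fix z assume "z \<in> eis_reps k"
    then obtain x y where z: "z = (x, y)" "x\<^sup>2 + x * y + y\<^sup>2 = k"
      by (cases z) auto
    have "\<bar>x\<bar> \<le> 2 * k" "\<bar>y\<bar> \<le> 2 * k"
      using eis_reps_bound[OF z(2)] abs_le_square[of x] abs_le_square[of y] by auto
    then show "z \<in> {-(2*k)..2*k} \<times> {-(2*k)..2*k}" using z by auto
  qed
qed simp

lemma card_eis_reps_1: "card (eis_reps 1) = 6"
proof -
  have "eis_reps 1 = {(1,0),(-1,0),(0,1),(0,-1),(1,-1),(-1,1)}"
  proof (intro equalityI subsetI)
    fix z :: "int \<times> int" assume "z \<in> eis_reps 1"
    then obtain x y where z: "z = (x, y)" "x\<^sup>2 + x * y + y\<^sup>2 = 1"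
      by (cases z) auto
    have sm: "u \<in> {-1,0,1}" if "u\<^sup>2 \<le> 2" for u :: int
    proof -
      have "\<bar>u\<bar> < 2"
        using that power2_less_imp_less[of "\<bar>u\<bar>" 2] by simp
      then show ?thesis by auto
    qed
    have b: "x\<^sup>2 + y\<^sup>2 \<le> 2" using eis_reps_bound[OF z(2)] by simp
    have "x\<^sup>2 \<le> 2" "y\<^sup>2 \<le> 2"
      using b zero_le_power2[of x] zero_le_power2[of y] by linarith+
    then have "x \<in> {-1,0,1}" "y \<in> {-1,0,1}" using sm by blast+
    then show "z \<in> {(1,0),(-1,0),(0,1),(0,-1),(1,-1),(-1,1)}"
      using z by auto
  qed auto
  then show ?thesis by simp
qed

(* Writing (x, y) as x + y \<theta> with \<theta>^2 = \<theta> - 1, the norm is x^2 + x y + y^2 and the bijection is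
   multiplication by the element 1 + \<theta> of norm 3. *)
lemma card_eis_reps_3: "card (eis_reps (3 * k)) = card (eis_reps k)"
proof -
  have "bij_betw (\<lambda>(x, y). (x - y, x + 2 * y)) (eis_reps k) (eis_reps (3 * k))"
  proof (rule bij_betw_imageI)
    show "inj_on (\<lambda>(x, y). (x - y, x + 2 * y)) (eis_reps k)"
      by (auto simp: inj_on_def)
    show "(\<lambda>(x, y). (x - y, x + 2 * y)) ` eis_reps k = eis_reps (3 * k)"
    proof (intro equalityI subsetI)
      fix z assume "z \<in> (\<lambda>(x, y). (x - y, x + 2 * y)) ` eis_reps k"
      then obtain x y where z: "z = (x - y, x + 2 * y)" "x\<^sup>2 + x * y + y\<^sup>2 = k"
        by (auto simp: eis_reps_def)
      then show "z \<in> eis_reps (3 * k)"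
        by (simp add: power2_eq_square algebra_simps)
    next
      fix z assume "z \<in> eis_reps (3 * k)"
      then obtain u v where z: "z = (u, v)" "u\<^sup>2 + u * v + v\<^sup>2 = 3 * k"
        by (cases z) auto
      have "(v - u)\<^sup>2 = 3 * (k - u * v)"
        using z(2) by (simp add: power2_eq_square algebra_simps)
      then have "3 dvd (v - u)\<^sup>2" by simp
      moreover have "prime (3::int)" by simp
      ultimately have "3 dvd v - u" using prime_dvd_power by blast
      then obtain y where y: "v - u = 3 * y" by blast
      have v: "v = u + 3 * y" using y by simp
      have "(u + y)\<^sup>2 + (u + y) * y + y\<^sup>2 = k"
        using z(2) unfolding v by (simp add: power2_eq_square algebra_simps)
      then show "z \<in> (\<lambda>(x, y). (x - y, x + 2 * y)) ` eis_reps k"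
        using z(1) v by (intro image_eqI[of _ _ "(u + y, y)"]) simp_all
    qed
  qed
  then show ?thesis by (rule bij_betw_same_card[symmetric])
qed

section \<open>Eisenstein integers of norm divisible by a prime\<close>

lemma eis_reps_scale:
  fixes p k :: int
  assumes "p > 0"
  shows "card {(x, y) \<in> eis_reps (p\<^sup>2 * k). p dvd x \<and> p dvd y} = card (eis_reps k)"
proof -
  have e: "(p * x)\<^sup>2 + (p * x) * (p * y) + (p * y)\<^sup>2 = p\<^sup>2 * k
      \<longleftrightarrow> x\<^sup>2 + x * y + y\<^sup>2 = k" for x y
  proof -
    have "(p * x)\<^sup>2 + (p * x) * (p * y) + (p * y)\<^sup>2 = p\<^sup>2 * (x\<^sup>2 + x * y + y\<^sup>2)"
      by (simp add: power2_eq_square algebra_simps)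
    then show ?thesis using assms by simp
  qed
  have "bij_betw (\<lambda>(x, y). (p * x, p * y)) (eis_reps k)
      {(x, y) \<in> eis_reps (p\<^sup>2 * k). p dvd x \<and> p dvd y}"
  proof (rule bij_betw_imageI)
    show "inj_on (\<lambda>(x, y). (p * x, p * y)) (eis_reps k)"
      using assms by (auto simp: inj_on_def)
    show "(\<lambda>(x, y). (p * x, p * y)) ` eis_reps k
        = {(x, y) \<in> eis_reps (p\<^sup>2 * k). p dvd x \<and> p dvd y}"
    proof (intro equalityI subsetI)
      fix z assume "z \<in> (\<lambda>(x, y). (p * x, p * y)) ` eis_reps k"
      then obtain x y where "z = (p * x, p * y)" "x\<^sup>2 + x * y + y\<^sup>2 = k"
        by (auto simp: eis_reps_def)
      then show "z \<in> {(x, y) \<in> eis_reps (p\<^sup>2 * k). p dvd x \<and> p dvd y}"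
        using e by simp
    next
      fix z assume "z \<in> {(x, y) \<in> eis_reps (p\<^sup>2 * k). p dvd x \<and> p dvd y}"
      then obtain x y where z: "z = (p * x, p * y)"
        "(p * x)\<^sup>2 + (p * x) * (p * y) + (p * y)\<^sup>2 = p\<^sup>2 * k"
        by (auto simp: dvd_def)
      then have "(x, y) \<in> eis_reps k" using e by simp
      then show "z \<in> (\<lambda>(x, y). (p * x, p * y)) ` eis_reps k"
        using z(1) by (intro image_eqI[of _ _ "(x, y)"]) simp_all
    qed
  qed
  then show ?thesis by (rule bij_betw_same_card[symmetric])
qed

text \<open>This is the term \<open>r(k / p)\<close> of the recursion: an element divisible by
  \<open>p\<close> has norm divisible by \<open>p^2\<close>, which forces \<open>p dvd k\<close>.
  For inert \<open>p\<close> it is the whole count; for split \<open>p\<close> it counts the overlap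
  in the inclusion-exclusion.\<close>

lemma eis_reps_scale_prime:
  fixes p k :: int
  assumes "prime p"
  shows "card {(x, y) \<in> eis_reps (p * k). p dvd x \<and> p dvd y}
    = (if p dvd k then card (eis_reps (k div p)) else 0)"
proof (cases "p dvd k")
  case True
  then obtain l where l: "k = p * l" by blast
  have "p > 0" using assms prime_gt_0_int by simp
  then show ?thesis
    using True eis_reps_scale[of p l] by (simp add: l power2_eq_square mult.assoc)
next
  case False
  have "\<not> (p dvd x \<and> p dvd y)" if q: "x\<^sup>2 + x * y + y\<^sup>2 = p * k" for x y
  proof
    assume "p dvd x \<and> p dvd y"
    then obtain a b where "x = p * a" "y = p * b" by blast
    then have "p * k = p * (p * (a\<^sup>2 + a * b + b\<^sup>2))"
      using q by (simp add: power2_eq_square algebra_simps)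
    then have "k = p * (a\<^sup>2 + a * b + b\<^sup>2)" using assms by auto
    then show False using False by auto
  qed
  then have "{(x, y) \<in> eis_reps (p * k). p dvd x \<and> p dvd y} = {}" by auto
  then have "card {(x, y) \<in> eis_reps (p * k). p dvd x \<and> p dvd y} = 0" by (simp only: card.empty)
  then show ?thesis using False by (simp only: if_False)
qed

text \<open>Cubing is injective on the nonzero residues modulo \<open>p\<close>, as 3 is coprime to
  \<open>p - 1\<close>. The norm divides \<open>x^3 - y^3\<close>, so a norm divisible by
  \<open>p\<close> would give \<open>x = y\<close> modulo \<open>p\<close> and then
  \<open>p dvd 3 * y^2\<close>. Hence only elements divisible by \<open>p\<close> have norm
  \<open>p * k\<close>.\<close>

lemma card_eis_reps_inert:
  fixes p k :: int
  assumes p: "prime p" "p mod 3 = 2"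
  shows "card (eis_reps (p * k)) = (if p dvd k then card (eis_reps (k div p)) else 0)"
proof -
  have pos: "p > 0" using p prime_gt_0_int by simp
  define q where "q = nat p"
  have q: "prime q" "p = int q" using p pos by (auto simp: q_def)
  have "q mod 3 = 2" using p(2) q(2) by (metis nat_int zmod_int of_nat_numeral)
  define s where "s = q div 3"
  have qs: "q = 3 * s + 2" using \<open>q mod 3 = 2\<close> s_def by presburger
  have cub: "p dvd y" if "p dvd x\<^sup>2 + x * y + y\<^sup>2" for x y :: int
  proof (rule ccontr)
    assume ny: "\<not> p dvd y"
    have "x^3 - y^3 = (x - y) * (x\<^sup>2 + x * y + y\<^sup>2)"
      by (simp add: power2_eq_square power3_eq_cube algebra_simps)
    then have c3: "[x^3 = y^3] (mod p)"
      using that by (simp add: cong_iff_dvd_diff)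
    have nx: "\<not> p dvd x"
    proof
      assume "p dvd x"
      then have "p dvd x\<^sup>2 + x * y" by (simp add: power2_eq_square)
      then have "p dvd y\<^sup>2" using that dvd_add_right_iff by blast
      then show False using ny p prime_dvd_power by blast
    qed
    have fer: "[z ^ (3 * s + 1) = 1] (mod p)" if "\<not> p dvd z" for z :: int
    proof -
      define w where "w = nat (z mod p)"
      have w: "int w = z mod p" using pos by (simp add: w_def)
      then have zw: "[int w = z] (mod p)" by (simp add: cong_def)
      then have "\<not> int q dvd int w" using that cong_dvd_iff q(2) by blast
      then have "\<not> q dvd w" by simp
      then have "[w ^ (q - 1) = 1] (mod q)" using fermat_theorem q(1) by blast
      then have "[int (w ^ (q - 1)) = int 1] (mod int q)" using cong_int_iff by blast
      then have "[int w ^ (3 * s + 1) = 1] (mod p)" using q(2) qs by simp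
      then show ?thesis by (rule cong_trans[OF cong_sym[OF cong_pow[OF zw]]])
    qed
    \<comment> \<open>By Fermat, \<open>z ^ (3 * s)\<close> is the inverse of \<open>z\<close>, and
      it depends only on the cube of \<open>z\<close>. So \<open>x\<close> and \<open>y\<close>,
      having equal cubes, have equal inverses.\<close>
    have "[x ^ (3 * s) = y ^ (3 * s)] (mod p)"
      using cong_pow[OF c3, of s] by (simp add: power_mult)
    then have a: "[x ^ (3 * s) * x = y ^ (3 * s) * x] (mod p)"
      by (rule cong_mult[OF _ cong_refl])
    have f: "[x ^ (3 * s) * x = 1] (mod p)" "[y ^ (3 * s) * y = 1] (mod p)"
      using fer[OF nx] fer[OF ny] by (simp_all add: mult.commute)
    have "[y ^ (3 * s) * x = y ^ (3 * s) * y] (mod p)"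
      by (rule cong_trans[OF cong_sym[OF a] cong_trans[OF f(1) cong_sym[OF f(2)]]])
    moreover have "coprime (y ^ (3 * s)) p"
      using prime_imp_coprime[OF p(1) ny] by (simp add: coprime_commute)
    ultimately have "[x = y] (mod p)"
      using cong_mult_lcancel by blast
    then have "[x\<^sup>2 + x * y + y\<^sup>2 = y\<^sup>2 + y * y + y\<^sup>2] (mod p)"
      by (intro cong_add cong_mult cong_pow cong_refl)
    then have "p dvd y\<^sup>2 + y * y + y\<^sup>2"
      using that cong_dvd_iff by blast
    then have "p dvd 3 * y\<^sup>2" by (simp add: power2_eq_square)
    moreover have "\<not> p dvd 3"
    proof
      assume "p dvd 3"
      then have "p = 3" using p(1) primes_dvd_imp_eq[of p 3] by simp
      then show False using p(2) by simp
    qed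
    ultimately have "p dvd y\<^sup>2" using p(1) prime_dvd_multD by blast
    then show False using ny p(1) prime_dvd_power by blast
  qed
  have "p dvd x \<and> p dvd y" if "x\<^sup>2 + x * y + y\<^sup>2 = p * k" for x y
  proof -
    have "p dvd x\<^sup>2 + x * y + y\<^sup>2" "p dvd y\<^sup>2 + y * x + x\<^sup>2"
      using that by (auto simp: algebra_simps)
    then show ?thesis using cub by blast
  qed
  then have "eis_reps (p * k) = {(x, y) \<in> eis_reps (p * k). p dvd x \<and> p dvd y}"
    by auto
  then show ?thesis
    using eis_reps_scale_prime[OF p(1), of k] by (rule trans[OF arg_cong[of _ _ card]])
qed

(* The set on the left consists of the multiples of a + b \<theta>, since
   the \<theta>-coordinate of (x + y \<theta>) times the conjugate of a + b \<theta> is a y - b x. *)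
lemma eis_mult_image:
  fixes a b p k :: int
  assumes p: "prime p" and ab: "a\<^sup>2 + a * b + b\<^sup>2 = p"
  shows "card {(x, y) \<in> eis_reps (p * k). p dvd a * y - b * x} = card (eis_reps k)"
proof -
  let ?f = "\<lambda>(x, y). (a * x - b * y, b * x + (a + b) * y)"
  have pos: "p > 0" using p prime_gt_0_int by simp
  have inv: "(a + b) * (a * x - b * y) + b * (b * x + (a + b) * y) = p * x"
    "a * (b * x + (a + b) * y) - b * (a * x - b * y) = p * y" for x y
    using ab by (auto simp: power2_eq_square algebra_simps)
  have nm: "(a * x - b * y)\<^sup>2 + (a * x - b * y) * (b * x + (a + b) * y)
      + (b * x + (a + b) * y)\<^sup>2 = p * (x\<^sup>2 + x * y + y\<^sup>2)" for x y
    unfolding ab[symmetric] by (simp add: power2_eq_square algebra_simps)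
  have "bij_betw ?f (eis_reps k) {(x, y) \<in> eis_reps (p * k). p dvd a * y - b * x}"
  proof (rule bij_betw_imageI)
    show "inj_on ?f (eis_reps k)"
    proof (rule inj_onI)
      fix z w assume "?f z = ?f w"
      then obtain x y x' y' where zw: "z = (x, y)" "w = (x', y')"
        and eq: "a * x - b * y = a * x' - b * y'"
          "b * x + (a + b) * y = b * x' + (a + b) * y'"
        by (cases z, cases w) auto
      have "p * x = p * x'" "p * y = p * y'"
        using inv[of x y] inv[of x' y'] eq by auto
      then show "z = w" using pos zw by simp
    qed
    show "?f ` eis_reps k = {(x, y) \<in> eis_reps (p * k). p dvd a * y - b * x}"
    proof (intro equalityI subsetI)
      fix z assume "z \<in> ?f ` eis_reps k"
      then obtain x y where z: "z = (a * x - b * y, b * x + (a + b) * y)"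
        "x\<^sup>2 + x * y + y\<^sup>2 = k"
        by (auto simp: eis_reps_def)
      then show "z \<in> {(x, y) \<in> eis_reps (p * k). p dvd a * y - b * x}"
        using inv(2)[of x y] nm[of x y] by simp
    next
      fix z assume "z \<in> {(x, y) \<in> eis_reps (p * k). p dvd a * y - b * x}"
      then obtain u v where z: "z = (u, v)" "u\<^sup>2 + u * v + v\<^sup>2 = p * k"
        and d: "p dvd a * v - b * u"
        by auto
      \<comment> \<open>The two linear forms are the coordinates of \<open>u + v \<theta>\<close>
        times the conjugate of \<open>a + b \<theta>\<close>. This product has norm divisible by
        \<open>p\<close>, so once its second coordinate is divisible by \<open>p\<close>, the first
        is as well; dividing by \<open>p\<close> then yields the preimage.\<close>
      have "((a + b) * u + b * v)\<^sup>2 + ((a + b) * u + b * v) * (a * v - b * u)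
          + (a * v - b * u)\<^sup>2 = p * (u\<^sup>2 + u * v + v\<^sup>2)"
        unfolding ab[symmetric] by (simp add: power2_eq_square algebra_simps)
      then have "p dvd ((a + b) * u + b * v)\<^sup>2 + ((a + b) * u + b * v) * (a * v - b * u)
          + (a * v - b * u)\<^sup>2" by simp
      then have "p dvd ((a + b) * u + b * v)\<^sup>2"
        using d by (simp add: dvd_add_left_iff power2_eq_square[of "a * v - b * u"])
      then have d2: "p dvd (a + b) * u + b * v" using p prime_dvd_power by blast
      obtain x y where xy: "(a + b) * u + b * v = p * x" "a * v - b * u = p * y"
        using d d2 by blast
      have "(a\<^sup>2 + a * b + b\<^sup>2) * u = a * (p * x) - b * (p * y)"
        "(a\<^sup>2 + a * b + b\<^sup>2) * v = b * (p * x) + (a + b) * (p * y)"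
        unfolding xy[symmetric] by (simp_all add: power2_eq_square algebra_simps)
      then have "p * u = a * (p * x) - b * (p * y)"
        "p * v = b * (p * x) + (a + b) * (p * y)"
        unfolding ab .
      then have "p * u = p * (a * x - b * y)" "p * v = p * (b * x + (a + b) * y)"
        by (simp_all add: algebra_simps)
      then have uv: "u = a * x - b * y" "v = b * x + (a + b) * y" using pos by simp_all
      have "p * (x\<^sup>2 + x * y + y\<^sup>2) = p * k" using nm[of x y] z(2) uv by simp
      then have "(x, y) \<in> eis_reps k" using pos by simp
      then show "z \<in> ?f ` eis_reps k"
        using z(1) uv by (intro image_eqI[of _ _ "(x, y)"]) simp_all
    qed
  qed
  then show ?thesis by (rule bij_betw_same_card[symmetric])
qed

(* Inclusion-exclusion: an element of norm p k is divisible by a + b \<theta> or by its conjugate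
   (a + b) - b \<theta>, and divisible by both only if it is divisible by p. *)
lemma card_eis_reps_split:
  fixes a b p k :: int
  assumes p: "prime p" "p \<noteq> 3" and ab: "a\<^sup>2 + a * b + b\<^sup>2 = p"
  shows "card (eis_reps (p * k)) + (if p dvd k then card (eis_reps (k div p)) else 0)
    = 2 * card (eis_reps k)"
proof -
  let ?X = "{(x, y) \<in> eis_reps (p * k). p dvd a * y - b * x}"
  let ?Y = "{(x, y) \<in> eis_reps (p * k). p dvd (a + b) * y - (- b) * x}"
  have pos: "p > 0" using p prime_gt_0_int by simp
  have ab': "(a + b)\<^sup>2 + (a + b) * (- b) + (- b)\<^sup>2 = p"
    using ab by (simp add: power2_eq_square algebra_simps)
  have X: "card ?X = card (eis_reps k)" by (rule eis_mult_image[OF p(1) ab])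
  have Y: "card ?Y = card (eis_reps k)" by (rule eis_mult_image[OF p(1) ab'])
  have un: "?X \<union> ?Y = eis_reps (p * k)"
  proof -
    have "p dvd a * y - b * x \<or> p dvd (a + b) * y - (- b) * x"
      if q: "x\<^sup>2 + x * y + y\<^sup>2 = p * k" for x y
    proof -
      have "(a * y - b * x) * ((a + b) * y - (- b) * x)
          = (a\<^sup>2 + a * b + b\<^sup>2) * y\<^sup>2 - b\<^sup>2 * (x\<^sup>2 + x * y + y\<^sup>2)"
        by (simp add: power2_eq_square algebra_simps)
      also have "\<dots> = p * (y\<^sup>2 - b\<^sup>2 * k)"
        unfolding ab q by (simp add: algebra_simps)
      finally have "p dvd (a * y - b * x) * ((a + b) * y - (- b) * x)" by simp
      then show ?thesis using p(1) prime_dvd_mult_iff by blast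
    qed
    then show ?thesis by fastforce
  qed
  have nb: "\<not> p dvd b"
  proof
    assume b: "p dvd b"
    then have "p dvd a * b + b\<^sup>2" by (simp add: power2_eq_square)
    then have "p dvd a\<^sup>2" using ab
      by (metis add.assoc dvd_add_left_iff dvd_refl)
    then have "p dvd a" using p prime_dvd_power by blast
    then have "p * p dvd a\<^sup>2" "p * p dvd a * b" "p * p dvd b\<^sup>2"
      using b by (auto simp: power2_eq_square intro: mult_dvd_mono)
    then have "p * p dvd p" using ab by (metis dvd_add)
    then show False using p(1) pos
      by (metis dvd_times_left_cancel_iff mult.right_neutral not_prime_unit order_less_irrefl)
  qed
  \<comment> \<open>\<open>2 * a + b\<close> is the trace of \<open>a + b \<theta>\<close>. If
    \<open>p\<close> divided it, \<open>4 * p = (2 * a + b)^2 + 3 * b^2\<close> would leave only the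
    ramified prime 3.\<close>
  have n2: "\<not> p dvd 2 * a + b"
  proof
    assume d: "p dvd 2 * a + b"
    have "3 * b\<^sup>2 = 4 * p - (2 * a + b)\<^sup>2"
      using ab by (simp add: power2_eq_square algebra_simps)
    moreover have "p dvd 4 * p - (2 * a + b)\<^sup>2"
      using d by (simp add: power2_eq_square)
    ultimately have "p dvd 3 * b\<^sup>2" by simp
    moreover have "\<not> p dvd 3" using p primes_dvd_imp_eq[of p 3] by auto
    ultimately have "p dvd b\<^sup>2" using p(1) prime_dvd_multD by blast
    then show False using nb p(1) prime_dvd_power by blast
  qed
  have int: "?X \<inter> ?Y = {(x, y) \<in> eis_reps (p * k). p dvd x \<and> p dvd y}"
  proof -
    have "p dvd x \<and> p dvd y"
      if d: "p dvd a * y - b * x" "p dvd (a + b) * y - (- b) * x" for x y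
    proof -
      have "p dvd (2 * a + b) * y"
        using dvd_add[OF d] by (simp add: algebra_simps)
      then have y: "p dvd y" using n2 p(1) prime_dvd_mult_iff by blast
      then have "p dvd b * x"
        using dvd_diff[OF dvd_mult[OF y, of a] d(1)] by simp
      then show ?thesis using y nb p(1) prime_dvd_mult_iff by blast
    qed
    moreover have "p dvd a * y - b * x \<and> p dvd (a + b) * y - (- b) * x"
      if "p dvd x" "p dvd y" for x y
      using that by simp
    ultimately have "p dvd a * y - b * x \<and> p dvd (a + b) * y - (- b) * x
        \<longleftrightarrow> p dvd x \<and> p dvd y" for x y
      by blast
    then show ?thesis by (simp add: set_eq_iff del: mult_minus_left) blast
  qed
  have fin: "finite ?X" "finite ?Y"
    by (auto intro: finite_subset[OF _ finite_eis_reps[of "p * k"]])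
  show ?thesis
    using card_Un_Int[OF fin] unfolding un int X Y eis_reps_scale_prime[OF p(1)] by simp
qed

text \<open>For a primitive root \<open>g\<close>, the power \<open>g ^ ((p - 1) div 3)\<close> has
  cube 1 but is not 1 itself, so it is a root of the quadratic factor of
  \<open>r^3 - 1\<close>.\<close>

lemma primitive_cube_root_mod_prime:
  assumes p: "prime p" "p mod 3 = (1::nat)"
  obtains r :: nat where "int p dvd (int r)\<^sup>2 + int r + 1"
proof -
  obtain g where g: "residue_primroot p g"
    using prime_primitive_root_exists p prime_gt_1_nat by blast
  define s where "s = (p - 1) div 3"
  have "p > 1" using p(1) prime_gt_1_nat by blast
  then have s: "p - 1 = 3 * s" "s > 0"
    using p(2) unfolding s_def by presburger+
  have cop: "coprime p g" and od: "ord p g = p - 1"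
    using g p(1) by (auto simp: residue_primroot_def totient_prime)
  define r where "r = g ^ s"
  have "[r ^ 3 = 1] (mod p)"
    using ord_works[of g p] od s by (simp add: r_def power_mult[symmetric] mult.commute)
  then have "[int (r ^ 3) = int 1] (mod int p)" using cong_int_iff by blast
  then have "int p dvd (int r)^3 - 1" by (simp add: cong_iff_dvd_diff)
  moreover have "(int r)^3 - 1 = (int r - 1) * ((int r)\<^sup>2 + int r + 1)"
    by (simp add: power2_eq_square power3_eq_cube algebra_simps)
  ultimately have "int p dvd (int r - 1) * ((int r)\<^sup>2 + int r + 1)" by simp
  moreover have "\<not> int p dvd int r - 1"
  proof
    assume "int p dvd int r - 1"
    then have "[int r = int 1] (mod int p)" by (simp add: cong_iff_dvd_diff)
    then have "[g ^ s = 1] (mod p)" unfolding r_def using cong_int_iff by blast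
    then have "p - 1 dvd s" using ord_divides od by metis
    then show False using s by (auto dest: dvd_imp_le)
  qed
  moreover have "prime (int p)" using p by simp
  ultimately have "int p dvd (int r)\<^sup>2 + int r + 1" using prime_dvd_mult_iff by blast
  then show ?thesis by (rule that)
qed

(* Thue's pigeonhole argument: two of the pairs (i, j) with 0 <= i, j <= sqrt p agree in
   i - r j modulo p; the norm of their difference is p or 2 p, and it cannot be twice an odd
   number. *)
lemma split_prime_eis_norm:
  fixes p :: nat
  assumes p: "prime p" "p mod 3 = 1"
  obtains a b :: int where "a\<^sup>2 + a * b + b\<^sup>2 = int p"
proof -
  obtain r where r: "int p dvd (int r)\<^sup>2 + int r + 1"
    using primitive_cube_root_mod_prime[OF p] .
  have pr: "prime (int p)" using p by simp
  define m where "m = floor_sqrt p"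
  have m1: "m\<^sup>2 \<le> p" "p < (m + 1)\<^sup>2"
    using floor_sqrt_power2_le[of p] Suc_floor_sqrt_power2_gt[of p] by (simp_all add: m_def)
  \<comment> \<open>A prime is not a square. This makes \<open>x^2\<close> and \<open>y^2\<close>
    strictly smaller than \<open>p\<close>, and so the norm strictly smaller than
    \<open>3 * p\<close>.\<close>
  have mne: "m\<^sup>2 \<noteq> p"
    using p(1) prime_product[of m m] by (auto simp: power2_eq_square)
  define I where "I = {0..int m} \<times> {0..int m}"
  define f where "f = (\<lambda>(i, j). (i - int r * j) mod int p)"
  have "card I = (m + 1)\<^sup>2" by (simp add: I_def card_cartesian_product power2_eq_square nat_add_distrib)
  moreover have "f ` I \<subseteq> {0..<int p}"
    using p(1) prime_gt_0_nat by (auto simp: f_def)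
  then have "card (f ` I) \<le> p" using card_mono[of "{0..<int p}" "f ` I"] by simp
  ultimately have "card (f ` I) < card I" using m1 by simp
  then have "\<not> inj_on f I" using pigeonhole by blast
  then obtain i j i' j' where ij: "(i, j) \<in> I" "(i', j') \<in> I" "(i, j) \<noteq> (i', j')"
    "f (i, j) = f (i', j')"
    by (auto simp: inj_on_def)
  define x where "x = i - i'"
  define y where "y = j - j'"
  have "int p dvd (i - int r * j) - (i' - int r * j')"
    using ij(4) by (simp add: f_def mod_eq_dvd_iff)
  then have xy: "int p dvd x - int r * y" by (simp add: x_def y_def algebra_simps)
  have ne: "x \<noteq> 0 \<or> y \<noteq> 0" using ij(3) by (auto simp: x_def y_def)
  have ax: "\<bar>x\<bar> \<le> int m" "\<bar>y\<bar> \<le> int m" using ij by (auto simp: x_def y_def I_def)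
  then have sq: "x\<^sup>2 \<le> (int m)\<^sup>2" "y\<^sup>2 \<le> (int m)\<^sup>2"
    using power_mono[of "\<bar>x\<bar>" "int m" 2] power_mono[of "\<bar>y\<bar>" "int m" 2] by simp_all
  have "(int m)\<^sup>2 < int p" using m1(1) mne
    by (metis le_neq_implies_less of_nat_less_iff of_nat_power)
  then have lt: "x\<^sup>2 < int p" "y\<^sup>2 < int p" using sq by (meson le_less_trans)+
  \<comment> \<open>Substituting \<open>r y\<close> for \<open>x\<close> turns the norm into
    \<open>y^2 (r^2 + r + 1)\<close>, a multiple of \<open>p\<close> by the choice of
    \<open>r\<close>.\<close>
  have "x\<^sup>2 + x * y + y\<^sup>2 = (x - int r * y) * (x + int r * y + y) + y\<^sup>2 * ((int r)\<^sup>2 + int r + 1)"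
    by (simp add: power2_eq_square algebra_simps)
  then have "int p dvd x\<^sup>2 + x * y + y\<^sup>2" using xy r by simp
  then obtain c where c: "x\<^sup>2 + x * y + y\<^sup>2 = int p * c" by blast
  have "2 * (x * y) \<le> x\<^sup>2 + y\<^sup>2"
    using zero_le_power2[of "x - y"] by (simp add: power2_eq_square algebra_simps)
  then have "int p * c < int p * 3" using c lt by linarith
  then have c3: "c < 3" using p(1) prime_gt_0_nat by simp
  have "0 < x\<^sup>2 + y\<^sup>2" using ne by (simp add: sum_power2_gt_zero_iff)
  then have "0 < int p * c" using eis_reps_bound[OF c] by linarith
  then have c0: "c > 0" using p(1) by (simp add: zero_less_mult_iff)
  have "c \<noteq> 2"
  proof
    assume "c = 2"
    then have e: "x\<^sup>2 + x * y + y\<^sup>2 = 2 * int p" using c by simp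
    then have "even (x\<^sup>2 + x * y + y\<^sup>2)" by simp
    then have "even x \<and> even y" by auto
    then obtain u v where "x = 2 * u" "y = 2 * v" by blast
    then have "int p = 2 * (u\<^sup>2 + u * v + v\<^sup>2)" using e by (simp add: power2_eq_square)
    then have "even p" by presburger
    then have "p = 2" using p(1) primes_dvd_imp_eq two_is_prime_nat by blast
    then show False using p(2) by simp
  qed
  then have "c = 1" using c0 c3 by linarith
  then show ?thesis using that c by simp
qed

section \<open>The character modulo 3 and its divisor sums\<close>

definition chi3 :: "nat \<Rightarrow> int" where
  "chi3 d = (if d mod 3 = 1 then 1 else if d mod 3 = 2 then -1 else 0)"

lemma chi3_mult: "chi3 (a * b) = chi3 a * chi3 b"
proof -
  have m: "chi3 d = chi3 (d mod 3)" for d by (simp add: chi3_def)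
  have "chi3 (a * b) = chi3 ((a mod 3) * (b mod 3))"
    using m[of "a * b"] m[of "(a mod 3) * (b mod 3)"] by (simp add: mod_mult_eq)
  moreover have "a mod 3 = 0 \<or> a mod 3 = 1 \<or> a mod 3 = 2" "b mod 3 = 0 \<or> b mod 3 = 1 \<or> b mod 3 = 2"
    by linarith+
  then have "chi3 ((a mod 3) * (b mod 3)) = chi3 (a mod 3) * chi3 (b mod 3)"
    by (elim disjE; simp only:; simp add: chi3_def)
  ultimately show ?thesis using m[of a] m[of b] by simp
qed

text \<open>For positive \<open>k\<close> this is the number of ideals of norm \<open>k\<close> in
  the Eisenstein integers, the coefficient of the Dedekind zeta function of the field.\<close>

definition chi3_sum :: "nat \<Rightarrow> int" where
  "chi3_sum k = (\<Sum>d | d dvd k. chi3 d)"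

text \<open>The divisors of \<open>p * k\<close> are those of \<open>k\<close> together with
  \<open>p\<close> times those of \<open>k\<close>. The two families overlap in \<open>p\<close>
  times the divisors of \<open>k div p\<close>, or nowhere if \<open>p\<close> does not divide
  \<open>k\<close>.\<close>

lemma chi3_sum_prime_mult:
  assumes p: "prime p" and k: "k > 0"
  shows "chi3_sum (p * k) + (if p dvd k then chi3 p * chi3_sum (k div p) else 0)
    = (1 + chi3 p) * chi3_sum k"
proof -
  let ?D = "\<lambda>k. {d. d dvd k}"
  have p0: "p > 0" using p prime_gt_0_nat by blast
  have img: "(\<Sum>d \<in> (*) p ` ?D m. chi3 d) = chi3 p * chi3_sum m" for m
    using p0 by (subst sum.reindex) (auto simp: inj_on_def chi3_sum_def chi3_mult sum_distrib_left)
  have un: "?D (p * k) = ?D k \<union> (*) p ` ?D k"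
  proof (intro equalityI subsetI)
    fix d assume d: "d \<in> ?D (p * k)"
    show "d \<in> ?D k \<union> (*) p ` ?D k"
    proof (cases "p dvd d")
      case True
      then show ?thesis using d p0 by (auto elim!: dvdE)
    next
      case False
      then have "coprime p d" using p prime_imp_coprime by blast
      then show ?thesis using d by (simp add: coprime_dvd_mult_right_iff coprime_commute)
    qed
  qed auto
  have int: "(\<Sum>d \<in> ?D k \<inter> (*) p ` ?D k. chi3 d)
      = (if p dvd k then chi3 p * chi3_sum (k div p) else 0)"
  proof (cases "p dvd k")
    case True
    then obtain l where l: "k = p * l" by blast
    have "?D k \<inter> (*) p ` ?D k = (*) p ` ?D l"
      using p0 by (auto simp: l)
    then show ?thesis using True p0 img[of l] by (simp add: l)
  next
    case False
    then have "?D k \<inter> (*) p ` ?D k = {}" by (auto dest: dvd_mult_left)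
    then show ?thesis using False by simp
  qed
  have "finite (?D k)" using k by simp
  then have "chi3_sum (p * k) + (\<Sum>d \<in> ?D k \<inter> (*) p ` ?D k. chi3 d)
      = chi3_sum k + (\<Sum>d \<in> (*) p ` ?D k. chi3 d)"
    unfolding chi3_sum_def un by (intro sum.union_inter) auto
  then show ?thesis unfolding int img by (simp add: algebra_simps)
qed

text \<open>The six units give the case \<open>k = 1\<close>. For \<open>k = p * m\<close> the prime
  is ramified, split or inert according to \<open>p mod 3\<close>, and each case reproduces the
  recursion of \<open>chi3_sum\<close>. The recursion also reaches back to \<open>m div p\<close>,
  hence the strong induction.\<close>

theorem card_eis_reps:
  assumes "k > 0"
  shows "int (card (eis_reps (int k))) = 6 * chi3_sum k"
  using assms
proof (induction k rule: less_induct)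
  case (less k)
  show ?case
  proof (cases "k = 1")
    case True
    then show ?thesis by (simp add: card_eis_reps_1 chi3_sum_def chi3_def)
  next
    case False
    then obtain p where p: "prime p" "p dvd k" using prime_factor_nat by blast
    then obtain m where m: "k = p * m" by blast
    have m0: "m > 0" using less.prems m by simp
    have p1: "p > 1" using p prime_gt_1_nat by blast
    have IH: "int (card (eis_reps (int m))) = 6 * chi3_sum m"
      using m m0 p1 by (intro less.IH) auto
    have IH2: "int (if int p dvd int m then card (eis_reps (int m div int p)) else 0)
        = 6 * (if p dvd m then chi3_sum (m div p) else 0)"
    proof (cases "p dvd m")
      case True
      then obtain l where l: "m = p * l" by blast
      have "l < k" "l > 0" using m m0 l p1 by (auto simp: n_less_m_mult_n less_le_trans)
      then have "int (card (eis_reps (int l))) = 6 * chi3_sum l" using less.IH by blast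
      then show ?thesis using l p1 by simp
    qed simp
    have R: "chi3_sum k + (if p dvd m then chi3 p * chi3_sum (m div p) else 0)
        = (1 + chi3 p) * chi3_sum m"
      using chi3_sum_prime_mult[OF p(1) m0] m by simp
    have pi: "prime (int p)" using p by simp
    have km: "int k = int p * int m" using m by simp
    consider "p mod 3 = 0" | "p mod 3 = 1" | "p mod 3 = 2" by linarith
    then show ?thesis
    proof cases
      case 1
      then have p3: "p = 3" using p(1) primes_dvd_imp_eq[of 3 p] by (simp add: dvd_eq_mod_eq_0)
      then have "chi3_sum k = chi3_sum m" using R unfolding p3 by (simp add: chi3_def split: if_splits)
      then show ?thesis using IH km p3 card_eis_reps_3[of "int m"] by simp
    next
      case 2
      then obtain a b :: int where "a\<^sup>2 + a * b + b\<^sup>2 = int p"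
        using split_prime_eis_norm p by blast
      moreover have "int p \<noteq> 3" using 2 by auto
      ultimately have "card (eis_reps (int p * int m))
          + (if int p dvd int m then card (eis_reps (int m div int p)) else 0)
          = 2 * card (eis_reps (int m))"
        using card_eis_reps_split[OF pi] by blast
      then have "int (card (eis_reps (int p * int m)))
          + int (if int p dvd int m then card (eis_reps (int m div int p)) else 0)
          = 2 * int (card (eis_reps (int m)))"
        by linarith
      then show ?thesis using R 2 unfolding IH2 IH km by (simp add: chi3_def split: if_splits)
    next
      case 3
      have "int p mod 3 = 2" using 3 by presburger
      then have "int (card (eis_reps (int k)))
          = int (if int p dvd int m then card (eis_reps (int m div int p)) else 0)"
        using card_eis_reps_inert[OF pi] km by metis
      then show ?thesis using R 3 unfolding IH2 by (simp add: chi3_def split: if_splits)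
    qed
  qed
qed

subsection \<open>Representations by \<open>x\<^sup>2 + 3 y\<^sup>2\<close> with odd entries\<close>

definition odd_reps :: "int \<Rightarrow> (int \<times> int) set" where
  "odd_reps k = {(x, y). odd x \<and> odd y \<and> x\<^sup>2 + 3 * y\<^sup>2 = 4 * k}"

lemma in_odd_reps [simp]: "(x, y) \<in> odd_reps k \<longleftrightarrow> odd x \<and> odd y \<and> x\<^sup>2 + 3 * y\<^sup>2 = 4 * k"
  by (simp add: odd_reps_def)

text \<open>Odd squares are 1 modulo 8, so the value is 4 modulo 8. This is why the later
  convolution runs over odd \<open>k\<close> only.\<close>

lemma odd_square_plus_three_odd_squares:
  fixes x y :: int
  assumes "odd x" "odd y"
  obtains k where "x\<^sup>2 + 3 * y\<^sup>2 = 4 * k" "odd k" "k > 0"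
proof -
  obtain i j where ij: "x = 2 * i + 1" "y = 2 * j + 1" using assms by (auto elim!: oddE)
  define k where "k = i * (i + 1) + 3 * (j * (j + 1)) + 1"
  have k: "x\<^sup>2 + 3 * y\<^sup>2 = 4 * k"
    by (simp add: ij k_def power2_eq_square algebra_simps)
  have "even (i * (i + 1))" "even (j * (j + 1))" by auto
  then have "odd k" unfolding k_def by simp
  moreover have "x\<^sup>2 > 0" using assms by (auto simp: zero_less_power2)
  then have "k > 0" using k zero_le_power2[of y] by linarith
  ultimately show ?thesis using that k by blast
qed

(* For odd k the rotation (x, y) -> (- y, x + y) permutes the three nonzero parity classes
   cyclically, and y is odd in two of them. *)
lemma card_odd_reps_eis:
  assumes "odd k"
  shows "3 * card (odd_reps k) = 2 * card (eis_reps k)"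
proof -
  define P where "P = (\<lambda>a b. {(x, y) \<in> eis_reps k. even x = a \<and> even y = b})"
  have inP: "(x, y) \<in> P a b \<longleftrightarrow> x\<^sup>2 + x * y + y\<^sup>2 = k \<and> even x = a \<and> even y = b" for x y a b
    by (simp add: P_def)
  have fin: "finite (P a b)" for a b
    unfolding P_def by (rule finite_subset[OF _ finite_eis_reps[of k]]) auto
  have "bij_betw (\<lambda>(x, y). (- y, x + y)) (P False True) (P True False)"
    by (rule bij_betw_byWitness[where f' = "\<lambda>(x, y). (x + y, - x)"])
      (auto simp: inP power2_eq_square algebra_simps)
  then have c1: "card (P False True) = card (P True False)" by (rule bij_betw_same_card)
  have "bij_betw (\<lambda>(x, y). (- y, x + y)) (P True False) (P False False)"
    by (rule bij_betw_byWitness[where f' = "\<lambda>(x, y). (x + y, - x)"])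
      (auto simp: inP power2_eq_square algebra_simps)
  then have c2: "card (P True False) = card (P False False)" by (rule bij_betw_same_card)
  have "eis_reps k = (P False True \<union> P True False) \<union> P False False"
  proof -
    have "odd x \<or> odd y" if "x\<^sup>2 + x * y + y\<^sup>2 = k" for x y
      using that assms by auto
    then show ?thesis by (auto simp: P_def)
  qed
  moreover have "card ((P False True \<union> P True False) \<union> P False False)
      = card (P False True) + card (P True False) + card (P False False)"
  proof -
    have "(P False True \<union> P True False) \<inter> P False False = {}" "P False True \<inter> P True False = {}"
      by (auto simp: P_def)
    then show ?thesis using fin by (simp add: card_Un_disjoint)
  qed
  ultimately have c3: "card (eis_reps k) = 3 * card (P True False)" using c1 c2 by simp
  \<comment> \<open>Completing the square gives
    \<open>4 * (x^2 + x * y + y^2) = (2 * x + y)^2 + 3 * y^2\<close>, and \<open>2 * x + y\<close>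
    is odd exactly when \<open>y\<close> is.\<close>
  have "bij_betw (\<lambda>(x, y). (2 * x + y, y)) (P True False \<union> P False False) (odd_reps k)"
  proof (rule bij_betw_byWitness[where f' = "\<lambda>(x, y). ((x - y) div 2, y)"])
    show "(\<lambda>(x, y). (2 * x + y, y)) ` (P True False \<union> P False False) \<subseteq> odd_reps k"
      by (auto simp: inP power2_eq_square algebra_simps)
    show "(\<lambda>(x, y). ((x - y) div 2, y)) ` odd_reps k \<subseteq> P True False \<union> P False False"
    proof
      fix z assume "z \<in> (\<lambda>(x, y). ((x - y) div 2, y)) ` odd_reps k"
      then obtain x y where z: "z = ((x - y) div 2, y)" "odd x" "odd y" "x\<^sup>2 + 3 * y\<^sup>2 = 4 * k"
        by (auto simp: odd_reps_def)
      have "even (x - y)" using z(2,3) by simp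
      then obtain u where "x - y = 2 * u" by (rule evenE)
      then have u: "x = 2 * u + y" by simp
      have "u\<^sup>2 + u * y + y\<^sup>2 = k"
        using z(4) unfolding u by (simp add: power2_eq_square algebra_simps)
      then show "z \<in> P True False \<union> P False False" using z(1,3) u inP by auto
    qed
  qed auto
  then have "card (odd_reps k) = card (P True False \<union> P False False)"
    by (rule bij_betw_same_card[symmetric])
  also have "\<dots> = card (P True False) + card (P False False)"
    by (rule card_Un_disjoint[OF fin fin]) (auto simp: P_def)
  finally show ?thesis using c2 c3 by simp
qed

lemma card_odd_reps:
  assumes "odd k"
  shows "int (card (odd_reps (int k))) = 4 * chi3_sum k"
proof -
  have "k > 0" using assms by (cases k) auto
  then show ?thesis
    using card_odd_reps_eis[of "int k"] card_eis_reps[of k] assms by simp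
qed

lemma finite_odd_reps: "finite (odd_reps k)"
proof -
  have "odd_reps k \<subseteq> (\<lambda>(x, y). (2 * x + y, y)) ` eis_reps k"
  proof
    fix z assume "z \<in> odd_reps k"
    then obtain x y where z: "z = (x, y)" "odd x" "odd y" "x\<^sup>2 + 3 * y\<^sup>2 = 4 * k"
      by (auto simp: odd_reps_def)
    have "even (x - y)" using z(2,3) by simp
    then obtain u where "x - y = 2 * u" by (rule evenE)
    then have u: "x = 2 * u + y" by simp
    have "u\<^sup>2 + u * y + y\<^sup>2 = k"
      using z(4) unfolding u by (simp add: power2_eq_square algebra_simps)
    then show "z \<in> (\<lambda>(x, y). (2 * x + y, y)) ` eis_reps k"
      using z(1) u by (intro image_eqI[of _ _ "(u, y)"]) simp_all
  qed
  then show ?thesis using finite_eis_reps finite_surj by blast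
qed

subsection \<open>A Liouville identity\<close>

text \<open>The entries \<open>a\<close> and \<open>b\<close> stand for divisors of \<open>k\<close>
  and \<open>2 * N - k\<close>, where \<open>k = a * x\<close> is odd, and \<open>x\<close>,
  \<open>y\<close> are their cofactors. A convolution of two divisor sums over odd \<open>k\<close>
  unfolds to a sum over these quadruples.\<close>

definition odd_quads :: "nat \<Rightarrow> (nat \<times> nat \<times> nat \<times> nat) set" where
  "odd_quads N = {(a, x, b, y). odd a \<and> odd x \<and> odd b \<and> odd y \<and> a * x + b * y = 2 * N}"

lemma in_odd_quads [simp]: "(a, x, b, y) \<in> odd_quads N \<longleftrightarrow>
    odd a \<and> odd x \<and> odd b \<and> odd y \<and> a * x + b * y = 2 * N"
  by (simp add: odd_quads_def)

lemma finite_odd_quads: "finite (odd_quads N)"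
proof (rule finite_subset)
  show "odd_quads N \<subseteq> {..2*N} \<times> {..2*N} \<times> {..2*N} \<times> {..2*N}"
  proof
    fix z assume "z \<in> odd_quads N"
    then obtain a x b y where z: "z = (a, x, b, y)" and o: "odd a" "odd x" "odd b" "odd y"
      and e: "a * x + b * y = 2 * N"
      by (auto simp: odd_quads_def)
    have "a > 0" "x > 0" "b > 0" "y > 0" using o by (auto intro: odd_pos)
    then have "a \<le> a * x" "x \<le> a * x" "b \<le> b * y" "y \<le> b * y" by auto
    then have "a \<le> 2 * N" "x \<le> 2 * N" "b \<le> 2 * N" "y \<le> 2 * N" using e by linarith+
    then show "z \<in> {..2*N} \<times> {..2*N} \<times> {..2*N} \<times> {..2*N}" using z by simp
  qed
qed simp

text \<open>For \<open>a = b\<close> the equation reads \<open>a * (x + y) = 2 * N\<close>, so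
  \<open>d = (x + y) div 2\<close> divides \<open>N\<close> with the odd cofactor \<open>a\<close>.
  Conversely, each such \<open>d\<close> leaves exactly \<open>d\<close> odd values of
  \<open>x\<close> below \<open>2 * d\<close>, which accounts for the weight
  \<open>d\<close>.\<close>

lemma sum_odd_quads_diagonal:
  fixes G :: "nat \<Rightarrow> int"
  assumes N: "N > 0"
  shows "(\<Sum>(a, x, b, y) \<in> {(a, x, b, y) \<in> odd_quads N. a = b}. G (x + y))
    = (\<Sum>d | d dvd N \<and> odd (N div d). int d * G (2 * d))"
proof -
  let ?D = "{d. d dvd N \<and> odd (N div d)}"
  have "(\<Sum>(a, x, b, y) \<in> {(a, x, b, y) \<in> odd_quads N. a = b}. G (x + y))
      = (\<Sum>(d, j) \<in> Sigma ?D (\<lambda>d. {..<d}). G (2 * d))"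
  proof (rule sum.reindex_bij_witness[where
        i = "\<lambda>(d, j). (N div d, 2 * j + 1, N div d, 2 * d - (2 * j + 1))"
        and j = "\<lambda>(a, x, b, y). ((x + y) div 2, x div 2)"])
    fix z assume "z \<in> {(a, x, b, y) \<in> odd_quads N. a = b}"
    then obtain a x y where z: "z = (a, x, a, y)" and o: "odd a" "odd x" "odd y"
      and e: "a * x + a * y = 2 * N"
      by (auto simp: odd_quads_def)
    obtain i j where ij: "x = 2 * i + 1" "y = 2 * j + 1" using o by (auto elim!: oddE)
    have N': "N = a * (i + j + 1)" using e by (simp add: ij algebra_simps)
    have a: "N div (i + j + 1) = a" unfolding N' by (rule nonzero_mult_div_cancel_right) simp
    show "(\<lambda>(d, j). (N div d, 2 * j + 1, N div d, 2 * d - (2 * j + 1)))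
        ((\<lambda>(a, x, b, y). ((x + y) div 2, x div 2)) z) = z"
      using a by (simp add: z ij)
    have "i + j + 1 dvd N" unfolding N' by (rule dvd_triv_right)
    then show "(\<lambda>(a, x, b, y). ((x + y) div 2, x div 2)) z \<in> Sigma ?D (\<lambda>d. {..<d})"
      using a o by (simp add: z ij)
    show "(case (\<lambda>(a, x, b, y). ((x + y) div 2, x div 2)) z of (d, j) \<Rightarrow> G (2 * d))
        = (case z of (a, x, b, y) \<Rightarrow> G (x + y))"
      by (simp add: z ij)
  next
    fix z assume "z \<in> Sigma ?D (\<lambda>d. {..<d})"
    then obtain d j where z: "z = (d, j)" "d dvd N" "odd (N div d)" "j < d" by auto
    then obtain c where c: "N = d * c" by blast
    obtain e where e: "d = j + 1 + e"
      using z(4) by (metis Suc_eq_plus1 add.commute less_iff_Suc_add add_Suc_right)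
    have cd: "N div d = c" using c z(4) by simp
    show "(\<lambda>(a, x, b, y). ((x + y) div 2, x div 2))
        ((\<lambda>(d, j). (N div d, 2 * j + 1, N div d, 2 * d - (2 * j + 1))) z) = z"
      by (simp add: z e)
    show "(\<lambda>(d, j). (N div d, 2 * j + 1, N div d, 2 * d - (2 * j + 1))) z
        \<in> {(a, x, b, y) \<in> odd_quads N. a = b}"
      using z(3) unfolding z(1) by (simp add: cd) (simp add: c e algebra_simps)
  qed
  also have "\<dots> = (\<Sum>d \<in> ?D. \<Sum>j<d. G (2 * d))"
    using N by (subst sum.Sigma) auto
  finally show ?thesis by simp
qed

(* In the coordinates u = a - b, v = x + y on the left and u = a + b, v = x - y on the right
   (with (x, b) renamed from (y, a) there), both sides run over solutions of u x + b v = 2 N.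
   For fixed u and v these form chains with step (x, b) -> (x + v, b - u); the left side picks
   from every chain the member with x < v, the right side the one with b < u. *)
lemma sum_odd_quads_off_diagonal:
  fixes F :: "nat \<Rightarrow> int"
  shows "(\<Sum>(a, x, b, y) \<in> {(a, x, b, y) \<in> odd_quads N. b < a}. F (a - b))
    = (\<Sum>(a, x, b, y) \<in> {(a, x, b, y) \<in> odd_quads N. y < x}. F (a + b))"
proof -
  define S where "S = {(u, x, b, v). even u \<and> even v \<and> odd x \<and> odd b
      \<and> u > 0 \<and> v > 0 \<and> u * x + b * v = 2 * N}"
  have inS: "(u, x, b, v) \<in> S \<longleftrightarrow>
      even u \<and> even v \<and> odd x \<and> odd b \<and> u > 0 \<and> v > 0 \<and> u * x + b * v = 2 * N" for u x b v
    by (simp add: S_def)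
  have shift: "(a - b) * x + b * (x + y) = a * x + b * y"
    "b * (y + x) + (a - b) * x = a * x + b * y"
    "(x + y) * b + x * (a - b) = x * a + y * b"
    "(x + y) * b + y * (a - b) = x * b + y * a"
    if "b \<le> a" for a b x y :: nat
    using that by (auto simp: le_iff_add algebra_simps)
  have "(\<Sum>(a, x, b, y) \<in> {(a, x, b, y) \<in> odd_quads N. b < a}. F (a - b))
      = (\<Sum>(u, x, b, v) \<in> {(u, x, b, v) \<in> S. x < v}. F u)"
    by (rule sum.reindex_bij_witness[where i = "\<lambda>(u, x, b, v). (u + b, x, b, v - x)"
          and j = "\<lambda>(a, x, b, y). (a - b, x, b, x + y)"])
      (auto simp: inS shift odd_pos)
  \<comment> \<open>Going down the chain takes \<open>b div u\<close> steps at once and leaves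
    \<open>b mod u\<close>; the way back takes \<open>x div v\<close> steps. As \<open>u\<close> and
    \<open>v\<close> are even, the entries \<open>x\<close> and \<open>b\<close> stay odd.\<close>
  also have "\<dots> = (\<Sum>(u, x, b, v) \<in> {(u, x, b, v) \<in> S. b < u}. F u)"
  proof (rule sum.reindex_bij_witness[where
        i = "\<lambda>(u, x, b, v). (u, x mod v, b + (x div v) * u, v)"
        and j = "\<lambda>(u, x, b, v). (u, x + (b div u) * v, b mod u, v)"])
    fix z assume "z \<in> {(u, x, b, v) \<in> S. x < v}"
    then obtain u x b v where z: "z = (u, x, b, v)" "x < v"
      and s: "even u" "even v" "odd x" "odd b" "u > 0" "v > 0" "u * x + b * v = 2 * N"
      by (auto simp: S_def)
    define q where "q = b div u"
    define r where "r = b mod u"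
    have b: "b = q * u + r" "r < u" using s by (auto simp: q_def r_def)
    show "(\<lambda>(u, x, b, v). (u, x mod v, b + (x div v) * u, v))
        ((\<lambda>(u, x, b, v). (u, x + (b div u) * v, b mod u, v)) z) = z"
      using z(2) s by (simp add: z(1))
    have "odd r" using s b by simp
    then show "(\<lambda>(u, x, b, v). (u, x + (b div u) * v, b mod u, v)) z
        \<in> {(u, x, b, v) \<in> S. b < u}"
      using s b(2) unfolding z(1) by (simp add: inS q_def[symmetric] r_def[symmetric])
        (simp add: b(1) algebra_simps)
    show "(case (\<lambda>(u, x, b, v). (u, x + (b div u) * v, b mod u, v)) z of (u, x, b, v) \<Rightarrow> F u)
        = (case z of (u, x, b, v) \<Rightarrow> F u)"
      by (simp add: z)
  next
    fix z assume "z \<in> {(u, x, b, v) \<in> S. b < u}"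
    then obtain u x b v where z: "z = (u, x, b, v)" "b < u"
      and s: "even u" "even v" "odd x" "odd b" "u > 0" "v > 0" "u * x + b * v = 2 * N"
      by (auto simp: S_def)
    define q where "q = x div v"
    define r where "r = x mod v"
    have x: "x = q * v + r" "r < v" using s by (auto simp: q_def r_def)
    show "(\<lambda>(u, x, b, v). (u, x + (b div u) * v, b mod u, v))
        ((\<lambda>(u, x, b, v). (u, x mod v, b + (x div v) * u, v)) z) = z"
      using z(2) s by (simp add: z(1))
    have "odd r" using s x by simp
    then show "(\<lambda>(u, x, b, v). (u, x mod v, b + (x div v) * u, v)) z
        \<in> {(u, x, b, v) \<in> S. x < v}"
      using s x(2) unfolding z(1) by (simp add: inS q_def[symmetric] r_def[symmetric])
        (simp add: x(1) algebra_simps)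
  qed
  also have "\<dots> = (\<Sum>(a, x, b, y) \<in> {(a, x, b, y) \<in> odd_quads N. y < x}. F (a + b))"
    by (rule sum.reindex_bij_witness[where i = "\<lambda>(a, x, b, y). (a + b, y, a, x - y)"
          and j = "\<lambda>(u, x, b, v). (b, v + x, u - b, x)"])
      (auto simp: inS shift odd_pos)
  finally show ?thesis .
qed

text \<open>Swapping \<open>(a, x)\<close> with \<open>(b, y)\<close> preserves \<open>f\<close> and
  exchanges \<open>p\<close> with \<open>c\<close>, so the regions \<open>c < p\<close> and
  \<open>p < c\<close> contribute equally. The lemma serves both for comparing \<open>a\<close> with
  \<open>b\<close> and for comparing \<open>x\<close> with \<open>y\<close>.\<close>

lemma sum_odd_quads_cases:
  fixes f :: "nat \<times> nat \<times> nat \<times> nat \<Rightarrow> int"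
  assumes "\<And>a x b y. (a, x, b, y) \<in> odd_quads N \<Longrightarrow> f (b, y, a, x) = f (a, x, b, y)"
    and "\<And>a x b y. p (b, y, a, x) = (c (a, x, b, y) :: nat)"
    and "\<And>a x b y. p (a, x, b, y) = (c (b, y, a, x) :: nat)"
  shows "sum f (odd_quads N) = sum f {z \<in> odd_quads N. p z = c z}
    + 2 * sum f {z \<in> odd_quads N. c z < p z}"
proof -
  have split: "odd_quads N = ({z \<in> odd_quads N. p z = c z} \<union> {z \<in> odd_quads N. c z < p z})
      \<union> {z \<in> odd_quads N. p z < c z}" by auto
  have "sum f (odd_quads N) = sum f {z \<in> odd_quads N. p z = c z}
      + sum f {z \<in> odd_quads N. c z < p z} + sum f {z \<in> odd_quads N. p z < c z}"
    by (subst split, subst sum.union_disjoint, auto simp: finite_odd_quads)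
      (subst sum.union_disjoint, auto simp: finite_odd_quads)
  moreover have "sum f {z \<in> odd_quads N. p z < c z} = sum f {z \<in> odd_quads N. c z < p z}"
    by (rule sum.reindex_bij_witness[where i = "\<lambda>(a, x, b, y). (b, y, a, x)"
          and j = "\<lambda>(a, x, b, y). (b, y, a, x)"])
      (auto simp: assms add.commute)
  ultimately show ?thesis by simp
qed

text \<open>The sum of \<open>F (a - b)\<close> is split by comparing \<open>a\<close> with
  \<open>b\<close>, that of \<open>F (a + b)\<close> by comparing \<open>x\<close> with
  \<open>y\<close>. The off-diagonal parts then cancel and only the two diagonals remain; evenness
  of \<open>F\<close> makes the first sum symmetric.\<close>

theorem liouville_odd_quads:
  fixes F :: "int \<Rightarrow> int"
  assumes N: "N > 0" and even: "\<And>m. F (- m) = F m"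
  shows "(\<Sum>(a, x, b, y) \<in> odd_quads N. F (int a - int b) - F (int a + int b))
    = (\<Sum>d | d dvd N \<and> odd (N div d). int d * (F 0 - F (2 * int d)))"
proof -
  have sym: "F (int b - int a) = F (int a - int b)" for a b
    using even[of "int a - int b"] by simp
  let ?m = "\<lambda>(a, x, b, y). F (int a - int b)" and ?p = "\<lambda>(a, x, b, y). F (int a + int b)"
  have L: "sum ?m (odd_quads N) = sum ?m {(a, x, b, y) \<in> odd_quads N. a = b}
      + 2 * sum ?m {(a, x, b, y) \<in> odd_quads N. b < a}"
  proof -
    have "{z \<in> odd_quads N. (\<lambda>(a, x, b, y). a) z = (\<lambda>(a, x, b, y). b) z}
        = {(a, x, b, y) \<in> odd_quads N. a = b}"
      "{z \<in> odd_quads N. (\<lambda>(a, x, b, y). b) z < (\<lambda>(a, x, b, y). a) z}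
        = {(a, x, b, y) \<in> odd_quads N. b < a}" by auto
    then show ?thesis
      using sum_odd_quads_cases[of N ?m "\<lambda>(a, x, b, y). a" "\<lambda>(a, x, b, y). b"] sym by simp
  qed
  have R: "sum ?p (odd_quads N) = sum ?p {(a, x, b, y) \<in> odd_quads N. x = y}
      + 2 * sum ?p {(a, x, b, y) \<in> odd_quads N. y < x}"
  proof -
    have "{z \<in> odd_quads N. (\<lambda>(a, x, b, y). x) z = (\<lambda>(a, x, b, y). y) z}
        = {(a, x, b, y) \<in> odd_quads N. x = y}"
      "{z \<in> odd_quads N. (\<lambda>(a, x, b, y). y) z < (\<lambda>(a, x, b, y). x) z}
        = {(a, x, b, y) \<in> odd_quads N. y < x}" by auto
    then show ?thesis
      using sum_odd_quads_cases[of N ?p "\<lambda>(a, x, b, y). x" "\<lambda>(a, x, b, y). y"]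
      by (simp add: add.commute)
  qed
  have off: "sum ?m {(a, x, b, y) \<in> odd_quads N. b < a} = sum ?p {(a, x, b, y) \<in> odd_quads N. y < x}"
  proof -
    have "sum ?m {(a, x, b, y) \<in> odd_quads N. b < a}
        = (\<Sum>(a, x, b, y) \<in> {(a, x, b, y) \<in> odd_quads N. b < a}. F (int (a - b)))"
      by (intro sum.cong) (auto simp: of_nat_diff)
    also have "\<dots> = (\<Sum>(a, x, b, y) \<in> {(a, x, b, y) \<in> odd_quads N. y < x}. F (int (a + b)))"
      by (rule sum_odd_quads_off_diagonal)
    finally show ?thesis by simp
  qed
  have dm: "sum ?m {(a, x, b, y) \<in> odd_quads N. a = b}
      = (\<Sum>d | d dvd N \<and> odd (N div d). int d * F 0)"
    unfolding sum_odd_quads_diagonal[OF N, of "\<lambda>_. F 0", symmetric]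
    by (intro sum.cong) auto
  \<comment> \<open>Exchanging each factor with its cofactor carries the diagonal
    \<open>x = y\<close> to \<open>a = b\<close>, so one evaluation serves both diagonals.\<close>
  have "sum ?p {(a, x, b, y) \<in> odd_quads N. x = y}
      = (\<Sum>(a, x, b, y) \<in> {(a, x, b, y) \<in> odd_quads N. a = b}. F (int (x + y)))"
    by (rule sum.reindex_bij_witness[where i = "\<lambda>(a, x, b, y). (x, a, y, b)"
          and j = "\<lambda>(a, x, b, y). (x, a, y, b)"])
      (auto simp: mult.commute)
  also have "\<dots> = (\<Sum>d | d dvd N \<and> odd (N div d). int d * F (2 * int d))"
    using sum_odd_quads_diagonal[OF N, of "\<lambda>s. F (int s)"] by simp
  finally have dp: "sum ?p {(a, x, b, y) \<in> odd_quads N. x = y}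
      = (\<Sum>d | d dvd N \<and> odd (N div d). int d * F (2 * int d))" .
  have "(\<Sum>(a, x, b, y) \<in> odd_quads N. F (int a - int b) - F (int a + int b))
      = sum ?m (odd_quads N) - sum ?p (odd_quads N)"
    unfolding sum_subtractf[symmetric] by (intro sum.cong) auto
  also have "\<dots> = (\<Sum>d | d dvd N \<and> odd (N div d). int d * F 0)
      - (\<Sum>d | d dvd N \<and> odd (N div d). int d * F (2 * int d))"
    using L R off dm dp by simp
  also have "\<dots> = (\<Sum>d | d dvd N \<and> odd (N div d). int d * (F 0 - F (2 * int d)))"
    unfolding sum_subtractf[symmetric] by (intro sum.cong) (auto simp: algebra_simps)
  finally show ?thesis .
qed

subsection \<open>Quaternary forms\<close>

lemma chi3_mult_eq: "chi3 a * chi3 b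
    = of_bool (3 dvd int a - int b) - of_bool (3 dvd int a + int b)"
proof -
  have a: "a mod 3 = 0 \<or> a mod 3 = 1 \<or> a mod 3 = 2" and b: "b mod 3 = 0 \<or> b mod 3 = 1 \<or> b mod 3 = 2"
    by linarith+
  have m: "3 dvd int a - int b \<longleftrightarrow> a mod 3 = b mod 3" "3 dvd int a + int b \<longleftrightarrow> (a mod 3 + b mod 3) mod 3 = 0"
    by presburger+
  show ?thesis unfolding m using a b by (elim disjE) (simp_all add: chi3_def)
qed

lemma sum_chi3_odd_quads:
  assumes "N > 0"
  shows "(\<Sum>(a, x, b, y) \<in> odd_quads N. chi3 a * chi3 b)
    = (\<Sum>d | d dvd N \<and> odd (N div d) \<and> \<not> 3 dvd d. int d)"
proof -
  have "(\<Sum>(a, x, b, y) \<in> odd_quads N. chi3 a * chi3 b)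
      = (\<Sum>d | d dvd N \<and> odd (N div d). int d * (of_bool (3 dvd (0::int)) - of_bool (3 dvd 2 * int d)))"
    unfolding chi3_mult_eq by (rule liouville_odd_quads[OF assms]) simp
  also have "\<dots> = (\<Sum>d | d dvd N \<and> odd (N div d). if \<not> 3 dvd d then int d else 0)"
  proof (intro sum.cong refl)
    fix d :: nat
    have "3 dvd 2 * int d \<longleftrightarrow> 3 dvd d" by presburger
    then show "int d * (of_bool (3 dvd (0::int)) - of_bool (3 dvd 2 * int d))
        = (if \<not> 3 dvd d then int d else 0)" by simp
  qed
  also have "\<dots> = (\<Sum>d \<in> {d \<in> {d. d dvd N \<and> odd (N div d)}. \<not> 3 dvd d}. int d)"
    using assms by (intro sum.inter_filter[symmetric]) simp
  also have "{d \<in> {d. d dvd N \<and> odd (N div d)}. \<not> 3 dvd d}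
      = {d. d dvd N \<and> odd (N div d) \<and> \<not> 3 dvd d}" by auto
  finally show ?thesis .
qed

text \<open>An odd cofactor forces the full power \<open>2 ^ \<alpha>\<close> into \<open>d\<close>,
  and \<open>d\<close> prime to 3 excludes every factor 3. What remains of \<open>d\<close> is an
  arbitrary divisor of \<open>m\<close>.\<close>

lemma sum_divisors_odd_codivisor:
  assumes N: "N = 2 ^ \<alpha> * 3 ^ \<beta> * m" and m: "coprime 6 m"
  shows "(\<Sum>d | d dvd N \<and> odd (N div d) \<and> \<not> 3 dvd d. d) = 2 ^ \<alpha> * sigma m"
proof -
  have m2: "odd m" and m3: "\<not> 3 dvd m"
    using m coprime_common_divisor[of 6 m 2] coprime_common_divisor[of 6 m 3] by auto
  have N0: "N > 0" using N m2 by (cases m) auto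
  have "{d. d dvd N \<and> odd (N div d) \<and> \<not> 3 dvd d} = (*) (2 ^ \<alpha>) ` {d. d dvd m}"
  proof (intro equalityI subsetI)
    fix d assume "d \<in> {d. d dvd N \<and> odd (N div d) \<and> \<not> 3 dvd d}"
    then have d: "d dvd N" "odd (N div d)" "\<not> 3 dvd d" by auto
    have "N = d * (N div d)" using d(1) by simp
    then have "2 ^ \<alpha> dvd d * (N div d)" using N by (metis dvd_triv_left mult.assoc)
    moreover have "coprime (2 ^ \<alpha>) (N div d)" using d(2) by simp
    ultimately have "2 ^ \<alpha> dvd d" using coprime_dvd_mult_left_iff by blast
    then obtain f where f: "d = 2 ^ \<alpha> * f" by blast
    have "2 ^ \<alpha> * f dvd 2 ^ \<alpha> * (3 ^ \<beta> * m)" using d(1) N f by (simp add: mult.assoc)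
    then have "f dvd 3 ^ \<beta> * m" by simp
    moreover have "coprime f (3 ^ \<beta>)"
    proof -
      have "\<not> 3 dvd f" using d(3) f dvd_mult by blast
      then have "coprime 3 f" using prime_imp_coprime[of 3 f] by simp
      then show ?thesis by (simp add: coprime_commute)
    qed
    ultimately have "f dvd m" using coprime_dvd_mult_right_iff by blast
    then show "d \<in> (*) (2 ^ \<alpha>) ` {d. d dvd m}" using f by blast
  next
    fix d assume "d \<in> (*) (2 ^ \<alpha>) ` {d. d dvd m}"
    then obtain f g where f: "d = 2 ^ \<alpha> * f" "m = f * g" by (auto elim!: dvdE)
    have e: "N = d * (3 ^ \<beta> * g)" using N f by simp
    have "d > 0" using N0 e by (cases d) auto
    then have "N div d = 3 ^ \<beta> * g" using e by simp
    moreover have "odd (3 ^ \<beta> * g)" using m2 f by simp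
    moreover have "\<not> 3 dvd 2 ^ \<alpha> * f"
    proof
      assume "3 dvd 2 ^ \<alpha> * f"
      then have "3 dvd (2::nat) ^ \<alpha> \<or> 3 dvd f" using prime_dvd_mult_iff[of 3 "2 ^ \<alpha>" f] by simp
      then show False
      proof
        assume "3 dvd (2::nat) ^ \<alpha>"
        then have "3 dvd (2::nat)" using prime_dvd_power[of "3::nat" 2 \<alpha>] by simp
        then show False by simp
      qed (use m3 f in auto)
    qed
    ultimately show "d \<in> {d. d dvd N \<and> odd (N div d) \<and> \<not> 3 dvd d}" using e f(1) by simp
  qed
  moreover have "(\<Sum>d \<in> (*) (2 ^ \<alpha>) ` {d. d dvd m}. d) = 2 ^ \<alpha> * sigma m"
    by (subst sum.reindex) (auto simp: inj_on_def sigma_def sum_distrib_left)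
  ultimately show ?thesis by simp
qed

section \<open>Odd solutions for the coefficients 1, 1, 3, 3\<close>

definition odd_reps1133 :: "nat \<Rightarrow> (int \<times> int \<times> int \<times> int) set" where
  "odd_reps1133 N = {(x, y, z, w). odd x \<and> odd y \<and> odd z \<and> odd w
     \<and> x\<^sup>2 + y\<^sup>2 + 3 * z\<^sup>2 + 3 * w\<^sup>2 = 8 * int N}"

text \<open>Solutions are sorted by the value \<open>4 * k\<close> of \<open>x^2 + 3 * z^2\<close>;
  then \<open>y^2 + 3 * w^2\<close> must equal \<open>4 * (2 * N - k)\<close>.\<close>

lemma card_odd_reps1133_conv:
  "card (odd_reps1133 N)
    = (\<Sum>k | odd k \<and> k < 2 * N. card (odd_reps (int k)) * card (odd_reps (int (2 * N - k))))"
proof -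
  let ?K = "{k. odd k \<and> k < 2 * N}"
  let ?S = "Sigma ?K (\<lambda>k. odd_reps (int k) \<times> odd_reps (int (2 * N - k)))"
  let ?f = "\<lambda>(k :: nat, (x :: int, z :: int), (y :: int, w :: int)). (x, y, z, w)"
  have "bij_betw ?f ?S (odd_reps1133 N)"
  proof (rule bij_betw_imageI)
    show "inj_on ?f ?S" by (auto simp: inj_on_def)
    show "?f ` ?S = odd_reps1133 N"
    proof (intro equalityI subsetI)
      fix q assume "q \<in> ?f ` ?S"
      then obtain k x y z w where q: "q = (x, y, z, w)" "k < 2 * N"
        "odd x" "odd z" "x\<^sup>2 + 3 * z\<^sup>2 = 4 * int k"
        "odd y" "odd w" "y\<^sup>2 + 3 * w\<^sup>2 = 4 * int (2 * N - k)"
        by auto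
      have "int (2 * N - k) = 2 * int N - int k" using q(2) by (simp add: of_nat_diff)
      then have "x\<^sup>2 + y\<^sup>2 + 3 * z\<^sup>2 + 3 * w\<^sup>2 = 8 * int N" using q by linarith
      then show "q \<in> odd_reps1133 N" using q by (simp add: odd_reps1133_def)
    next
      fix q assume "q \<in> odd_reps1133 N"
      then obtain x y z w where q: "q = (x, y, z, w)" "odd x" "odd y" "odd z" "odd w"
        "x\<^sup>2 + y\<^sup>2 + 3 * z\<^sup>2 + 3 * w\<^sup>2 = 8 * int N"
        by (auto simp: odd_reps1133_def)
      obtain k l where k: "x\<^sup>2 + 3 * z\<^sup>2 = 4 * k" "odd k" "k > 0"
        and l: "y\<^sup>2 + 3 * w\<^sup>2 = 4 * l" "odd l" "l > 0"
        using odd_square_plus_three_odd_squares q by metis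
      have kl: "k + l = 2 * int N" using q(6) k(1) l(1) by linarith
      define k' where "k' = nat k"
      have k': "k = int k'" using k by (simp add: k'_def)
      have lt: "k' < 2 * N" using kl l(3) k' by linarith
      then have "int (2 * N - k') = l" using kl k' by (simp add: of_nat_diff)
      then have "(k', (x, z), (y, w)) \<in> ?S" using q k l lt k' by simp
      then show "q \<in> ?f ` ?S" using q(1) by (intro image_eqI[of _ _ "(k', (x, z), (y, w))"]) simp_all
    qed
  qed
  then have "card (odd_reps1133 N) = card ?S" by (rule bij_betw_same_card[symmetric])
  also have "\<dots> = (\<Sum>k \<in> ?K. card (odd_reps (int k) \<times> odd_reps (int (2 * N - k))))"
    by (intro card_SigmaI) (auto simp: finite_odd_reps)
  finally show ?thesis by (simp add: card_cartesian_product)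
qed

lemma sum_chi3_sum_conv:
  "(\<Sum>k | odd k \<and> k < 2 * N. chi3_sum k * chi3_sum (2 * N - k))
    = (\<Sum>(a, x, b, y) \<in> odd_quads N. chi3 a * chi3 b)"
proof -
  let ?K = "{k. odd k \<and> k < 2 * N}"
  have "(\<Sum>k \<in> ?K. chi3_sum k * chi3_sum (2 * N - k))
      = (\<Sum>k \<in> ?K. \<Sum>(a, b) \<in> {a. a dvd k} \<times> {b. b dvd 2 * N - k}. chi3 a * chi3 b)"
    by (simp add: chi3_sum_def sum_product sum.cartesian_product)
  also have "\<dots> = (\<Sum>(k, a, b) \<in> Sigma ?K (\<lambda>k. {a. a dvd k} \<times> {b. b dvd 2 * N - k}). chi3 a * chi3 b)"
    by (subst sum.Sigma) (auto simp: odd_pos)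
  also have "\<dots> = (\<Sum>(a, x, b, y) \<in> odd_quads N. chi3 a * chi3 b)"
  proof (rule sum.reindex_bij_witness[where
        i = "\<lambda>(a, x, b, y). (a * x, a, b)"
        and j = "\<lambda>(k, a, b). (a, k div a, b, (2 * N - k) div b)"])
    fix s assume "s \<in> Sigma ?K (\<lambda>k. {a. a dvd k} \<times> {b. b dvd 2 * N - k})"
    then obtain k a b where s: "s = (k, a, b)" "odd k" "k < 2 * N" "a dvd k" "b dvd 2 * N - k"
      by auto
    show "(\<lambda>(a, x, b, y). (a * x, a, b)) ((\<lambda>(k, a, b). (a, k div a, b, (2 * N - k) div b)) s) = s"
      using s by simp
    obtain x y where xy: "k = a * x" "2 * N - k = b * y" using s by (auto elim!: dvdE)
    have o: "odd (2 * N - k)" using s by simp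
    have od: "odd a" "odd x" using s(2) unfolding xy(1) by simp_all
    have od': "odd b" "odd y" using o unfolding xy(2) by simp_all
    have "a > 0" "b > 0" using od od' by (auto intro: odd_pos)
    then have "k div a = x" "(2 * N - k) div b = y" using xy by auto
    moreover have "a * x + b * y = 2 * N" using xy s(3) by linarith
    ultimately show "(\<lambda>(k, a, b). (a, k div a, b, (2 * N - k) div b)) s \<in> odd_quads N"
      using s(1) od od' by simp
    show "(case (\<lambda>(k, a, b). (a, k div a, b, (2 * N - k) div b)) s of (a, x, b, y) \<Rightarrow> chi3 a * chi3 b)
        = (case s of (k, a, b) \<Rightarrow> chi3 a * chi3 b)"
      using s(1) by simp
  next
    fix s assume "s \<in> odd_quads N"
    then obtain a x b y where s: "s = (a, x, b, y)" "odd a" "odd x" "odd b" "odd y"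
      "a * x + b * y = 2 * N"
      by (auto simp: odd_quads_def)
    have p: "a > 0" "b > 0" "y > 0" using s by (auto intro: odd_pos)
    have d: "2 * N - a * x = b * y" using s(6) by linarith
    have lt: "a * x < 2 * N" using s(6) p by (metis less_add_same_cancel1 nat_0_less_mult_iff)
    show "(\<lambda>(k, a, b). (a, k div a, b, (2 * N - k) div b)) ((\<lambda>(a, x, b, y). (a * x, a, b)) s) = s"
      using s(1) d p by simp
    show "(\<lambda>(a, x, b, y). (a * x, a, b)) s \<in> Sigma ?K (\<lambda>k. {a. a dvd k} \<times> {b. b dvd 2 * N - k})"
      using s(1-5) d lt by simp
  qed
  finally show ?thesis .
qed

theorem card_odd_reps1133:
  assumes N: "N = 2 ^ \<alpha> * 3 ^ \<beta> * m" and m: "coprime 6 m"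
  shows "card (odd_reps1133 N) = 2 ^ (\<alpha> + 4) * sigma m"
proof -
  have "odd m" using m coprime_common_divisor[of 6 m 2] by auto
  then have N0: "N > 0" using N by (cases m) auto
  have "int (card (odd_reps1133 N))
      = (\<Sum>k | odd k \<and> k < 2 * N. int (card (odd_reps (int k))) * int (card (odd_reps (int (2 * N - k)))))"
    unfolding card_odd_reps1133_conv of_nat_sum of_nat_mult ..
  also have "\<dots> = (\<Sum>k | odd k \<and> k < 2 * N. 16 * (chi3_sum k * chi3_sum (2 * N - k)))"
  proof (intro sum.cong refl)
    fix k assume "k \<in> {k. odd k \<and> k < 2 * N}"
    then have "odd k" "odd (2 * N - k)" by simp_all
    then show "int (card (odd_reps (int k))) * int (card (odd_reps (int (2 * N - k))))
        = 16 * (chi3_sum k * chi3_sum (2 * N - k))"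
      using card_odd_reps[of k] card_odd_reps[of "2 * N - k"] by simp
  qed
  also have "\<dots> = 16 * (\<Sum>d | d dvd N \<and> odd (N div d) \<and> \<not> 3 dvd d. int d)"
    unfolding sum_distrib_left[symmetric] sum_chi3_sum_conv sum_chi3_odd_quads[OF N0] ..
  also have "\<dots> = int (16 * (\<Sum>d | d dvd N \<and> odd (N div d) \<and> \<not> 3 dvd d. d))" by simp
  also have "\<dots> = int (2 ^ (\<alpha> + 4) * sigma m)"
    unfolding sum_divisors_odd_codivisor[OF N m] by (simp add: power_add)
  finally show ?thesis by linarith
qed

section \<open>Reduction of the coefficients 1, 3, 3, 9 modulo 3\<close>

definition odd_reps1339 :: "nat \<Rightarrow> (int \<times> int \<times> int \<times> int) set" where
  "odd_reps1339 N = {(x, y, z, w). odd x \<and> odd y \<and> odd z \<and> odd w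
     \<and> x\<^sup>2 + 3 * y\<^sup>2 + 3 * z\<^sup>2 + 9 * w\<^sup>2 = 8 * int N}"

lemma odd_square_tri: "(2 * x - 1)\<^sup>2 = 8 * tri x + 1"
  using two_tri[of x] by (simp add: power2_eq_square algebra_simps)

text \<open>Since \<open>8 * tri x + 1\<close> is an odd square, multiplying the equation by 8 adds
  \<open>1 + 3 + 3 + 9 = 8 * 2\<close> to \<open>8 * n\<close>; this is the origin of
  \<open>n + 2\<close>.\<close>

lemma bij_betw_tri_reps_odd_reps1339:
  "bij_betw (\<lambda>(x, y, z, w). (2 * x - 1, 2 * y - 1, 2 * z - 1, 2 * w - 1))
     (tri_reps 1 3 3 9 n) (odd_reps1339 (n + 2))"
proof -
  let ?f = "\<lambda>(x, y, z, w). (2 * x - 1, 2 * y - 1, 2 * z - 1, 2 * w - 1 :: int)"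
  have eq: "(2 * x - 1)\<^sup>2 + 3 * (2 * y - 1)\<^sup>2 + 3 * (2 * z - 1)\<^sup>2 + 9 * (2 * w - 1)\<^sup>2 = 8 * int (n + 2)
      \<longleftrightarrow> (x, y, z, w) \<in> tri_reps 1 3 3 9 n" for x y z w
    unfolding odd_square_tri tri_reps_def by auto
  show ?thesis
  proof (rule bij_betw_imageI)
    show "inj_on ?f (tri_reps 1 3 3 9 n)" by (auto simp: inj_on_def)
    show "?f ` tri_reps 1 3 3 9 n = odd_reps1339 (n + 2)"
    proof (intro equalityI subsetI)
      fix q assume "q \<in> ?f ` tri_reps 1 3 3 9 n"
      then obtain x y z w where "q = ?f (x, y, z, w)" "(x, y, z, w) \<in> tri_reps 1 3 3 9 n"
        by auto
      then show "q \<in> odd_reps1339 (n + 2)"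
        using eq[of x y z w] by (simp add: odd_reps1339_def)
    next
      fix q assume "q \<in> odd_reps1339 (n + 2)"
      then obtain x y z w where q: "q = (x, y, z, w)" "odd x" "odd y" "odd z" "odd w"
        "x\<^sup>2 + 3 * y\<^sup>2 + 3 * z\<^sup>2 + 9 * w\<^sup>2 = 8 * int (n + 2)"
        by (auto simp: odd_reps1339_def)
      have odd_shift: "\<exists>v. u = 2 * v - 1" if "odd u" for u :: int
        using that by presburger
      obtain x' y' z' w' where v: "x = 2 * x' - 1" "y = 2 * y' - 1" "z = 2 * z' - 1" "w = 2 * w' - 1"
        using odd_shift q(2-5) by meson
      then have "(x', y', z', w') \<in> tri_reps 1 3 3 9 n"
        using q(6) eq[of x' y' z' w'] by simp
      then show "q \<in> ?f ` tri_reps 1 3 3 9 n"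
        using q(1) v by (intro image_eqI[of _ _ "(x', y', z', w')"]) simp_all
    qed
  qed
qed

lemma t_1339: "t 1 3 3 9 n = card (odd_reps1339 (n + 2))"
  unfolding t_def by (rule bij_betw_same_card[OF bij_betw_tri_reps_odd_reps1339])

lemma square_mod_3: "(x::int)\<^sup>2 mod 3 = (if 3 dvd x then 0 else 1)"
proof -
  have sq: "x\<^sup>2 mod 3 = (x mod 3)\<^sup>2 mod 3" by (simp only: power_mod)
  have "x mod 3 = 0 \<or> x mod 3 = 1 \<or> x mod 3 = 2" by presburger
  then show ?thesis unfolding sq dvd_eq_mod_eq_0 by (elim disjE) (simp_all only:, simp_all)
qed

text \<open>Modulo 3 only \<open>x^2\<close> survives, and \<open>8 * N\<close> is 2, not a
  square.\<close>

lemma odd_reps1339_empty: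
  assumes "N mod 3 = 1"
  shows "odd_reps1339 N = {}"
proof -
  have False if "x\<^sup>2 + 3 * y\<^sup>2 + 3 * z\<^sup>2 + 9 * w\<^sup>2 = 8 * int N" for x y z w :: int
  proof -
    have "x\<^sup>2 mod 3 = 2" using that assms by presburger
    then show False using square_mod_3[of x] by (simp split: if_splits)
  qed
  then show ?thesis by (auto simp: odd_reps1339_def)
qed

text \<open>The equation forces \<open>3 dvd x\<close>. Putting \<open>x = 3 * u\<close> and
  dividing by 3 turns the coefficients 1, 3, 3, 9 into 3, 1, 1, 3, so \<open>y\<close> and
  \<open>z\<close> become the variables with coefficient 1.\<close>

lemma card_odd_reps1339_mult_3: "card (odd_reps1339 (3 * m)) = card (odd_reps1133 m)"
proof -
  have "bij_betw (\<lambda>(y, z, x, w). (3 * x, y, z, w)) (odd_reps1133 m) (odd_reps1339 (3 * m))"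
  proof (rule bij_betw_byWitness[where f' = "\<lambda>(x, y, z, w). (y, z, x div 3, w)"])
    show "\<forall>q \<in> odd_reps1339 (3 * m). (\<lambda>(y, z, x, w). (3 * x, y, z, w))
        ((\<lambda>(x, y, z, w). (y, z, x div 3, w)) q) = q"
      and "(\<lambda>(x, y, z, w). (y, z, x div 3, w)) ` odd_reps1339 (3 * m) \<subseteq> odd_reps1133 m"
    proof -
      have "3 * (x div 3) = x \<and> (y, z, x div 3, w) \<in> odd_reps1133 m"
        if "(x, y, z, w) \<in> odd_reps1339 (3 * m)" for x y z w
      proof -
        have o: "odd x" "odd y" "odd z" "odd w"
          and e: "x\<^sup>2 + 3 * y\<^sup>2 + 3 * z\<^sup>2 + 9 * w\<^sup>2 = 24 * int m"
          using that by (auto simp: odd_reps1339_def)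
        have "x\<^sup>2 mod 3 = 0" using e by presburger
        then have "3 dvd x" using square_mod_3[of x] by (simp split: if_splits)
        then obtain u where u: "x = 3 * u" by blast
        have "y\<^sup>2 + z\<^sup>2 + 3 * u\<^sup>2 + 3 * w\<^sup>2 = 8 * int m"
          using e unfolding u by (simp add: power2_eq_square)
        then show ?thesis using o u by (simp add: odd_reps1133_def)
      qed
      then show "\<forall>q \<in> odd_reps1339 (3 * m). (\<lambda>(y, z, x, w). (3 * x, y, z, w))
        ((\<lambda>(x, y, z, w). (y, z, x div 3, w)) q) = q"
        and "(\<lambda>(x, y, z, w). (y, z, x div 3, w)) ` odd_reps1339 (3 * m) \<subseteq> odd_reps1133 m"
        by auto
    qed
  qed (auto simp: odd_reps1133_def odd_reps1339_def power2_eq_square)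
  then show ?thesis by (rule bij_betw_same_card[symmetric])
qed

(* x^2 + y^2 = 1 (mod 3), so exactly one of x and y is divisible by 3. *)
lemma card_odd_reps1133_mod_3:
  assumes "N mod 3 = 2"
  shows "card (odd_reps1133 N) = 2 * card (odd_reps1339 N)"
proof -
  \<comment> \<open>The coordinate divisible by 3 contributes 9 times a square, so its third becomes
    the last entry in \<open>odd_reps1339\<close>. The two images record which of the two
    coordinates it is.\<close>
  let ?X = "(\<lambda>(y, z, w, x). (3 * x, y, z, w)) ` odd_reps1339 N"
  let ?Y = "(\<lambda>(x, z, w, y). (x, 3 * y, z, w)) ` odd_reps1339 N"
  have cX: "card ?X = card (odd_reps1339 N)" and cY: "card ?Y = card (odd_reps1339 N)"
    by (intro card_image; auto simp: inj_on_def)+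
  have one: "3 dvd x \<longleftrightarrow> \<not> 3 dvd y"
    if "x\<^sup>2 + y\<^sup>2 + 3 * z\<^sup>2 + 3 * w\<^sup>2 = 8 * int N" for x y z w :: int
  proof -
    have "(x\<^sup>2 mod 3 + y\<^sup>2 mod 3) mod 3 = 1" using that assms by presburger
    then show ?thesis unfolding square_mod_3 by (simp split: if_splits)
  qed
  have un: "odd_reps1133 N = ?X \<union> ?Y"
  proof (intro equalityI subsetI)
    fix q assume "q \<in> odd_reps1133 N"
    then obtain x y z w where q: "q = (x, y, z, w)" "odd x" "odd y" "odd z" "odd w"
      "x\<^sup>2 + y\<^sup>2 + 3 * z\<^sup>2 + 3 * w\<^sup>2 = 8 * int N"
      by (auto simp: odd_reps1133_def)
    show "q \<in> ?X \<union> ?Y"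
    proof (cases "3 dvd x")
      case True
      then obtain u where u: "x = 3 * u" by blast
      have "(y, z, w, u) \<in> odd_reps1339 N"
        using q u by (simp add: odd_reps1339_def power2_eq_square)
      then have "q \<in> ?X" using q(1) u by (intro image_eqI[of _ _ "(y, z, w, u)"]) simp_all
      then show ?thesis by simp
    next
      case False
      then have "3 dvd y" using one[OF q(6)] by blast
      then obtain u where u: "y = 3 * u" by blast
      have "(x, z, w, u) \<in> odd_reps1339 N"
        using q u by (simp add: odd_reps1339_def power2_eq_square)
      then have "q \<in> ?Y" using q(1) u by (intro image_eqI[of _ _ "(x, z, w, u)"]) simp_all
      then show ?thesis by simp
    qed
  qed (auto simp: odd_reps1339_def odd_reps1133_def power2_eq_square)
  have disj: "?X \<inter> ?Y = {}"
  proof -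
    have False if "q \<in> ?X" "q \<in> ?Y" for q
    proof -
      obtain x y z w where q: "q = (x, y, z, w)" by (cases q) auto
      have "q \<in> odd_reps1133 N" using that un by blast
      then have "x\<^sup>2 + y\<^sup>2 + 3 * z\<^sup>2 + 3 * w\<^sup>2 = 8 * int N" by (simp add: q odd_reps1133_def)
      moreover have "3 dvd x" "3 dvd y" using that by (auto simp: q)
      ultimately show False using one by blast
    qed
    then show ?thesis by blast
  qed
  have fin: "finite (odd_reps1339 N)"
  proof (cases "N < 2")
    case False
    define n where "n = N - 2"
    then have "N = n + 2" using False by simp
    then show ?thesis using bij_betw_finite[OF bij_betw_tri_reps_odd_reps1339[of n]] finite_tri_reps[of 1 3 3 9 n]
      by simp
  next
    case True
    then show ?thesis using assms by simp
  qed
  show ?thesis unfolding un using cX cY disj fin by (simp add: card_Un_disjoint)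
qed

theorem theorem4p1:
  fixes n \<alpha> \<beta> n\<^sub>1 :: nat
  assumes "n > 0"
    and "n + 2 = 2 ^ \<alpha> * 3 ^ \<beta> * n\<^sub>1"
    and "gcd 6 n\<^sub>1 = 1"
  shows "(n mod 6 = 2 \<or> n mod 6 = 5 \<longrightarrow> t 1 3 3 9 n = 0) \<and>
         (n mod 6 = 1 \<longrightarrow> t 1 3 3 9 n = 16 * sigma n\<^sub>1) \<and>
         (n mod 6 = 4 \<longrightarrow> t 1 3 3 9 n = 2 ^ (\<alpha> + 4) * sigma n\<^sub>1) \<and>
         (n mod 6 = 3 \<longrightarrow> t 1 3 3 9 n = 8 * sigma n\<^sub>1) \<and>
         (n mod 6 = 0 \<longrightarrow> t 1 3 3 9 n = 2 ^ (\<alpha> + 3) * sigma n\<^sub>1)"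
proof -
  have cop: "coprime 6 n\<^sub>1" using assms(3) by (simp only: coprime_iff_gcd_eq_1)
  have zero: "t 1 3 3 9 n = 0" if "n mod 3 = 2"
  proof -
    have "(n + 2) mod 3 = 1" using that by presburger
    then show ?thesis unfolding t_1339 by (simp only: odd_reps1339_empty card.empty)
  qed
  have one: "t 1 3 3 9 n = 2 ^ (\<alpha> + 4) * sigma n\<^sub>1" if "n mod 3 = 1"
  proof -
    have "3 dvd n + 2" using that by presburger
    have "\<beta> \<noteq> 0"
    proof
      assume "\<beta> = 0"
      then have "3 dvd 2 ^ \<alpha> * n\<^sub>1" using \<open>3 dvd n + 2\<close> assms(2) by simp
      moreover have "coprime 3 ((2::nat) ^ \<alpha>)" by simp
      ultimately have "3 dvd n\<^sub>1" using coprime_dvd_mult_right_iff by blast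
      then show False using cop coprime_common_divisor[of 6 n\<^sub>1 3] by simp
    qed
    then obtain \<gamma> where \<gamma>: "\<beta> = Suc \<gamma>" using not0_implies_Suc by blast
    \<comment> \<open>Cancelling one factor 3 keeps \<alpha> and \<open>n\<^sub>1\<close>, which
      determine the count for the coefficients 1, 1, 3, 3.\<close>
    have "n + 2 = 3 * (2 ^ \<alpha> * 3 ^ \<gamma> * n\<^sub>1)" using assms(2) \<gamma> by simp
    then show ?thesis
      unfolding t_1339 by (simp only: card_odd_reps1339_mult_3 card_odd_reps1133[OF refl cop])
  qed
  have two: "t 1 3 3 9 n = 2 ^ (\<alpha> + 3) * sigma n\<^sub>1" if "n mod 3 = 0"
  proof -
    have "(n + 2) mod 3 = 2" using that by presburger
    then have "2 * t 1 3 3 9 n = 2 ^ (\<alpha> + 4) * sigma n\<^sub>1"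
      unfolding t_1339 using card_odd_reps1133_mod_3 card_odd_reps1133[OF assms(2) cop] by simp
    then show ?thesis by (simp add: power_add)
  qed
  \<comment> \<open>The value is governed by \<open>n mod 3\<close>; the odd classes modulo 6 are
    the specialization to \<alpha> = 0.\<close>
  have \<alpha>: "\<alpha> = 0" if "odd n"
  proof (rule ccontr)
    assume "\<alpha> \<noteq> 0"
    then have "even (n + 2)" using assms(2) by simp
    then show False using that by simp
  qed
  show ?thesis
  proof (intro conjI impI)
    assume "n mod 6 = 2 \<or> n mod 6 = 5"
    then have "n mod 3 = 2" by presburger
    then show "t 1 3 3 9 n = 0" by (rule zero)
  next
    assume "n mod 6 = 1"
    then have "n mod 3 = 1" "odd n" by presburger+
    then show "t 1 3 3 9 n = 16 * sigma n\<^sub>1" using one \<alpha> by simp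
  next
    assume "n mod 6 = 4"
    then have "n mod 3 = 1" by presburger
    then show "t 1 3 3 9 n = 2 ^ (\<alpha> + 4) * sigma n\<^sub>1" by (rule one)
  next
    assume "n mod 6 = 3"
    then have "n mod 3 = 0" "odd n" by presburger+
    then show "t 1 3 3 9 n = 8 * sigma n\<^sub>1" using two \<alpha> by simp
  next
    assume "n mod 6 = 0"
    then have "n mod 3 = 0" by presburger
    then show "t 1 3 3 9 n = 2 ^ (\<alpha> + 3) * sigma n\<^sub>1" by (rule two)
  qed
qed

end
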